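(* Let $\mathcal{M}=(M,\mathcal{A}_M)$ be a $\mathbb{Z}_2^n$-supermanifold of dimension $p|\mathbf{q}$. Then the base topological space $M$ carries a smooth manifold structure of dimension $p$, and, for the sheaf $C^\infty_M$ of smooth functions of this structure, there exists a short exact sequence of sheaves $$0\to\mathcal{J}_M\to\mathcal{A}_M\xrightarrow{\ \varepsilon\ }C^\infty_M\to 0 ,$$ where $\varepsilon$ is the base projection and $\mathcal{J}_M$ is its kernel.
   Context: Fix $n\in\mathbb{N}$. $\mathbb{Z}_2=\{0,1\}$, and $\langle i,j\rangle=\sum_k i_kj_k$ for $i,j\in\mathbb{Z}_2^n$. A $\mathbb{Z}_2^n$-commutative associative unital $\mathbb{R}$-algebra is a $\mathbb{Z}_2^n$-graded associative unital $\mathbb{R}$-algebra $A=\bigoplus_{i\in\mathbb{Z}_2^n}A^i$ with $ab=(-1)^{\langle i,j\rangle}ba$ for $a\in A^i$, $b\in A^j$. Superdomains. Order $\mathbb{Z}_2^n\setminus\{0\}$ lexicographically. Let $p\in\mathbb{N}$, $\mathbf{q}=(q_1,\dots,q_{2^n-1})\in\mathbb{N}^{2^n-1}$, $q=\sum_kq_k$, and let $\xi^1,\dots,\xi^q$ be formal variables with degrees in $\mathbb{Z}_2^n\setminus\{0\}$, exactly $q_k$ of them having as degree the $k$-th element of $\mathbb{Z}_2^n\setminus\{0\}$. For $U\subset\mathbb{R}^p$ open, $C^\infty_U[[\xi^1,\dots,\xi^q]]$ denotes the sheaf $V\mapsto C^\infty(V)[[\xi^1,\dots,\xi^q]]$ of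 formal power series $\sum_\mu f_\mu(x)\xi^\mu$ with $f_\mu\in C^\infty(V)$, where functions of $x$ have degree $0$ and are central, and $\xi^a\xi^b=(-1)^{\langle\deg\xi^a,\deg\xi^b\rangle}\xi^b\xi^a$ (variables with odd $\langle\deg\xi^a,\deg\xi^a\rangle$ thus occur with exponent at most 1). The pair $(U,C^\infty_U[[\xi^1,\dots,\xi^q]])$ is a $\mathbb{Z}_2^n$-superdomain of dimension $p|\mathbf{q}$. Supermanifolds. A locally $\mathbb{Z}_2^n$-ringed space is a pair $(M,\mathcal{A}_M)$ of a Hausdorff second-countable topological space $M$ and a sheaf $\mathcal{A}_M$ of $\mathbb{Z}_2^n$-commutative associative unital $\mathbb{R}$-algebras whose stalks are local, i.e. have a unique maximal homogeneous ideal. A morphism of such spaces is a continuous base map $\varphi:M\to N$ together with graded unital $\mathbb{R}$-algebra morphisms $\mathcal{B}_N(V)\to\mathcal{A}_M(\varphi^{-1}(V))$, $V\subset N$ open, commuting with restrictions, whose induced maps on stalks send the maximal homogeneous ideal into the maximal homogeneous ideal. A $\mathbb{Z}_2^n$-supermanifold of dimension $p|\mathbf{q}$ is a locally $\mathbb{Z}_2^n$-ringed space locally isomorphic to a $\mathbb{Z}_2^n$-superdomain of dimension $p|\mathbf{q}$. Base projection. For $U\subset M$ open, $f\in\mathcal{A}_M(U)$ and $m\in U$, $\varepsilon_U(f)(m)$ denotes the unique $k\in\mathbb{R}$ such that $f-k$ is not invertible in any neighborhood of $m$ in $U$; this defines a function $\varepsilon_U(f):U\to\mathbb{R}$, and $\mathcal{J}_M(U)=\ker\varepsilon_U$.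 *)

theory Defs
  imports
    "HOL-Analysis.Analysis"
    "HOL-Algebra.Module"
    "HOL-Algebra.Ideal"
    "HOL-Library.List_Lexorder"
begin

section \<open>The grading group\<close>

text \<open>Elements of \<open>\<int>\<^sub>2\<^sup>n\<close> are Boolean lists of length \<open>n\<close>, with \<open>False\<close> as \<open>0\<close> and \<open>True\<close> as \<open>1\<close>.\<close>

definition Z2n :: "nat \<Rightarrow> bool list set" where
  "Z2n n = {i. length i = n}"

definition deg_zero :: "nat \<Rightarrow> bool list" where
  "deg_zero n = replicate n False"

definition deg_add :: "bool list \<Rightarrow> bool list \<Rightarrow> bool list" where
  "deg_add i j = map2 (\<noteq>) i j"

text \<open>Only the parity of \<open>\<langle>i,j\<rangle>\<close> is ever used, so it is computed in \<open>\<nat>\<close>.\<close>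

definition deg_pairing :: "nat \<Rightarrow> bool list \<Rightarrow> bool list \<Rightarrow> nat" where
  "deg_pairing n i j = (\<Sum>k<n. of_bool (i ! k) * of_bool (j ! k))"

text \<open>The order on \<^typ>\<open>bool list\<close> is the lexicographic one, with \<open>False < True\<close>.\<close>

definition nonzero_degs :: "nat \<Rightarrow> bool list list" where
  "nonzero_degs n = sorted_list_of_set (Z2n n - {deg_zero n})"

section \<open>Graded vector spaces and algebras\<close>

definition real_ring :: "real ring" where
  "real_ring = \<lparr>carrier = UNIV, mult = (*), one = 1, zero = 0, add = (+)\<rparr>"

record 'a graded = "(real, 'a) module" +
  homog :: "bool list \<Rightarrow> 'a set"

locale graded_space = Module.module real_ring A for n :: nat and A (structure) +
  assumes homog_submodule: "i \<in> Z2n n \<Longrightarrow> submodule (homog A i) real_ring A"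
    and direct_sum:
      "a \<in> carrier A \<Longrightarrow>
        \<exists>!c. c \<in> (\<Pi>\<^sub>E i\<in>Z2n n. homog A i) \<and> a = (\<Oplus>\<^bsub>A\<^esub>i\<in>Z2n n. c i)"

locale graded_comm_algebra = graded_space n A + ring A for n :: nat and A (structure) +
  assumes smult_mult_left:
      "\<lbrakk>x \<in> carrier A; y \<in> carrier A\<rbrakk> \<Longrightarrow> (r \<odot> x) \<otimes> y = r \<odot> (x \<otimes> y)"
    and smult_mult_right:
      "\<lbrakk>x \<in> carrier A; y \<in> carrier A\<rbrakk> \<Longrightarrow> x \<otimes> (r \<odot> y) = r \<odot> (x \<otimes> y)"
    and homog_mult:
      "\<lbrakk>i \<in> Z2n n; j \<in> Z2n n; x \<in> homog A i; y \<in> homog A j\<rbrakk> \<Longrightarrow> x \<otimes> y \<in> homog A (deg_add i j)"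
    and graded_commute:
      "\<lbrakk>i \<in> Z2n n; j \<in> Z2n n; x \<in> homog A i; y \<in> homog A j\<rbrakk>
        \<Longrightarrow> x \<otimes> y = ((-1) ^ deg_pairing n i j) \<odot> (y \<otimes> x)"

definition graded_linear ::
    "nat \<Rightarrow> ('a, 'x) graded_scheme \<Rightarrow> ('b, 'y) graded_scheme \<Rightarrow> ('a \<Rightarrow> 'b) \<Rightarrow> bool" where
  "graded_linear n A B h \<longleftrightarrow>
     h \<in> carrier A \<rightarrow> carrier B \<and>
     (\<forall>x\<in>carrier A. \<forall>y\<in>carrier A. h (x \<oplus>\<^bsub>A\<^esub> y) = h x \<oplus>\<^bsub>B\<^esub> h y) \<and>
     (\<forall>r. \<forall>x\<in>carrier A. h (r \<odot>\<^bsub>A\<^esub> x) = r \<odot>\<^bsub>B\<^esub> h x) \<and>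
     (\<forall>i\<in>Z2n n. h ` homog A i \<subseteq> homog B i)"

definition graded_algebra_hom ::
    "nat \<Rightarrow> ('a, 'x) graded_scheme \<Rightarrow> ('b, 'y) graded_scheme \<Rightarrow> ('a \<Rightarrow> 'b) \<Rightarrow> bool" where
  "graded_algebra_hom n A B h \<longleftrightarrow>
     graded_linear n A B h \<and>
     (\<forall>x\<in>carrier A. \<forall>y\<in>carrier A. h (x \<otimes>\<^bsub>A\<^esub> y) = h x \<otimes>\<^bsub>B\<^esub> h y) \<and>
     h \<one>\<^bsub>A\<^esub> = \<one>\<^bsub>B\<^esub>"

definition homogeneous_ideal :: "nat \<Rightarrow> ('a, 'x) graded_scheme \<Rightarrow> 'a set \<Rightarrow> bool" where
  "homogeneous_ideal n A I \<longleftrightarrow>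
     ideal I A \<and>
     (\<forall>c \<in> (\<Pi> i\<in>Z2n n. homog A i). (\<Oplus>\<^bsub>A\<^esub>i\<in>Z2n n. c i) \<in> I \<longrightarrow> (\<forall>i\<in>Z2n n. c i \<in> I))"

definition maximal_homogeneous_ideal :: "nat \<Rightarrow> ('a, 'x) graded_scheme \<Rightarrow> 'a set \<Rightarrow> bool" where
  "maximal_homogeneous_ideal n A I \<longleftrightarrow>
     homogeneous_ideal n A I \<and> I \<noteq> carrier A \<and>
     (\<forall>J. homogeneous_ideal n A J \<and> I \<subseteq> J \<and> J \<noteq> carrier A \<longrightarrow> J = I)"

section \<open>Sheaves and stalks\<close>

text \<open>
  A presheaf together with its base space. The components \<open>sect U\<close> and \<open>restr U V\<close>
  (restriction from \<open>U\<close> to \<open>V\<close>) are meaningful only for open \<open>V \<subseteq> U\<close>.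
\<close>

record ('m, 'a) ringed_space =
  base :: "'m topology"
  sect :: "'m set \<Rightarrow> 'a graded"
  restr :: "'m set \<Rightarrow> 'm set \<Rightarrow> 'a \<Rightarrow> 'a"

definition graded_sheaf :: "nat \<Rightarrow> ('m, 'a) ringed_space \<Rightarrow> bool" where
  "graded_sheaf n F \<longleftrightarrow>
     (\<forall>U. openin (base F) U \<longrightarrow> graded_space n (sect F U)) \<and>
     (\<forall>U V. openin (base F) U \<and> openin (base F) V \<and> V \<subseteq> U \<longrightarrow>
        graded_linear n (sect F U) (sect F V) (restr F U V)) \<and>
     (\<forall>U. openin (base F) U \<longrightarrow> (\<forall>f\<in>carrier (sect F U). restr F U U f = f)) \<and>
     (\<forall>U V W. openin (base F) U \<and> openin (base F) V \<and> openin (base F) W \<and> V \<subseteq> U \<and> W \<subseteq> V \<longrightarrow>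
        (\<forall>f\<in>carrier (sect F U). restr F V W (restr F U V f) = restr F U W f)) \<and>
     (\<forall>\<U> s. (\<forall>U\<in>\<U>. openin (base F) U \<and> s U \<in> carrier (sect F U)) \<and>
        (\<forall>U\<in>\<U>. \<forall>V\<in>\<U>. restr F U (U \<inter> V) (s U) = restr F V (U \<inter> V) (s V)) \<longrightarrow>
        (\<exists>!f. f \<in> carrier (sect F (\<Union>\<U>)) \<and> (\<forall>U\<in>\<U>. restr F (\<Union>\<U>) U f = s U)))"

definition graded_comm_algebra_sheaf :: "nat \<Rightarrow> ('m, 'a) ringed_space \<Rightarrow> bool" where
  "graded_comm_algebra_sheaf n F \<longleftrightarrow>
     graded_sheaf n F \<and>
     (\<forall>U. openin (base F) U \<longrightarrow> graded_comm_algebra n (sect F U)) \<and>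
     (\<forall>U V. openin (base F) U \<and> openin (base F) V \<and> V \<subseteq> U \<longrightarrow>
        graded_algebra_hom n (sect F U) (sect F V) (restr F U V))"

text \<open>Germs are equivalence classes of pairs (open neighbourhood of \<open>m\<close>, section over it).\<close>

definition germ :: "('m, 'a) ringed_space \<Rightarrow> 'm \<Rightarrow> 'm set \<Rightarrow> 'a \<Rightarrow> ('m set \<times> 'a) set" where
  "germ F m U f = {(V, g). openin (base F) V \<and> m \<in> V \<and> g \<in> carrier (sect F V) \<and>
     (\<exists>W. openin (base F) W \<and> m \<in> W \<and> W \<subseteq> U \<inter> V \<and> restr F U W f = restr F V W g)}"

text \<open>
  As for cosets, an operation on germs is the union over all representatives of the class of
  the result; for a sheaf all classes in that union coincide.
\<close>

definition germ_op2 ::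
    "('m, 'a) ringed_space \<Rightarrow> 'm \<Rightarrow> ('m set \<Rightarrow> 'a \<Rightarrow> 'a \<Rightarrow> 'a) \<Rightarrow>
     ('m set \<times> 'a) set \<Rightarrow> ('m set \<times> 'a) set \<Rightarrow> ('m set \<times> 'a) set" where
  "germ_op2 F m op a b =
     (\<Union>(U, f)\<in>a. \<Union>(V, g)\<in>b.
        germ F m (U \<inter> V) (op (U \<inter> V) (restr F U (U \<inter> V) f) (restr F V (U \<inter> V) g)))"

definition stalk :: "('m, 'a) ringed_space \<Rightarrow> 'm \<Rightarrow> ('m set \<times> 'a) set graded" where
  "stalk F m =
     \<lparr>carrier = {germ F m U f |U f. openin (base F) U \<and> m \<in> U \<and> f \<in> carrier (sect F U)},
      mult = germ_op2 F m (\<lambda>U. mult (sect F U)),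
      one = germ F m (topspace (base F)) (one (sect F (topspace (base F)))),
      zero = germ F m (topspace (base F)) (zero (sect F (topspace (base F)))),
      add = germ_op2 F m (\<lambda>U. add (sect F U)),
      smult = (\<lambda>r a. \<Union>(U, f)\<in>a. germ F m U (smult (sect F U) r f)),
      homog = (\<lambda>i. {germ F m U f |U f. openin (base F) U \<and> m \<in> U \<and> f \<in> homog (sect F U) i})\<rparr>"

definition preimage :: "('m, 'a) ringed_space \<Rightarrow> ('m \<Rightarrow> 'k) \<Rightarrow> 'k set \<Rightarrow> 'm set" where
  "preimage M \<phi> V = {m \<in> topspace (base M). \<phi> m \<in> V}"

definition stalk_map ::
    "('m, 'a) ringed_space \<Rightarrow> ('m \<Rightarrow> 'k) \<Rightarrow> ('k set \<Rightarrow> 'b \<Rightarrow> 'a) \<Rightarrow> 'm \<Rightarrow>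
     ('k set \<times> 'b) set \<Rightarrow> ('m set \<times> 'a) set" where
  "stalk_map M \<phi> \<psi> m b = (\<Union>(V, g)\<in>b. germ M m (preimage M \<phi> V) (\<psi> V g))"

section \<open>Locally ringed spaces and their morphisms\<close>

definition locally_ringed_space :: "nat \<Rightarrow> ('m, 'a) ringed_space \<Rightarrow> bool" where
  "locally_ringed_space n M \<longleftrightarrow>
     Hausdorff_space (base M) \<and> second_countable (base M) \<and>
     graded_comm_algebra_sheaf n M \<and>
     (\<forall>m\<in>topspace (base M). \<exists>!I. maximal_homogeneous_ideal n (stalk M m) I)"

definition lrs_morphism ::
    "nat \<Rightarrow> ('m, 'a) ringed_space \<Rightarrow> ('k, 'b) ringed_space \<Rightarrow>
     ('m \<Rightarrow> 'k) \<Rightarrow> ('k set \<Rightarrow> 'b \<Rightarrow> 'a) \<Rightarrow> bool" where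
  "lrs_morphism n M N \<phi> \<psi> \<longleftrightarrow>
     continuous_map (base M) (base N) \<phi> \<and>
     (\<forall>V. openin (base N) V \<longrightarrow>
        graded_algebra_hom n (sect N V) (sect M (preimage M \<phi> V)) (\<psi> V)) \<and>
     (\<forall>V W. openin (base N) V \<and> openin (base N) W \<and> W \<subseteq> V \<longrightarrow>
        (\<forall>g\<in>carrier (sect N V).
           \<psi> W (restr N V W g) = restr M (preimage M \<phi> V) (preimage M \<phi> W) (\<psi> V g))) \<and>
     (\<forall>m\<in>topspace (base M). \<forall>I J.
        maximal_homogeneous_ideal n (stalk M m) I \<and>
        maximal_homogeneous_ideal n (stalk N (\<phi> m)) J \<longrightarrow> stalk_map M \<phi> \<psi> m ` J \<subseteq> I)"

definition lrs_isomorphic ::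
    "nat \<Rightarrow> ('m, 'a) ringed_space \<Rightarrow> ('k, 'b) ringed_space \<Rightarrow> bool" where
  "lrs_isomorphic n M N \<longleftrightarrow>
     (\<exists>\<phi> \<psi> \<phi>' \<psi>'.
        lrs_morphism n M N \<phi> \<psi> \<and> lrs_morphism n N M \<phi>' \<psi>' \<and>
        (\<forall>x\<in>topspace (base M). \<phi>' (\<phi> x) = x) \<and>
        (\<forall>y\<in>topspace (base N). \<phi> (\<phi>' y) = y) \<and>
        (\<forall>V. openin (base N) V \<longrightarrow>
           (\<forall>g\<in>carrier (sect N V). \<psi>' (preimage M \<phi> V) (\<psi> V g) = g)) \<and>
        (\<forall>U. openin (base M) U \<longrightarrow>
           (\<forall>f\<in>carrier (sect M U). \<psi> (preimage N \<phi>' U) (\<psi>' U f) = f)))"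

definition open_subspace :: "('m, 'a) ringed_space \<Rightarrow> 'm set \<Rightarrow> ('m, 'a) ringed_space" where
  "open_subspace M U = M\<lparr>base := subtopology (base M) U\<rparr>"

section \<open>Smooth functions on open subsets of Euclidean space\<close>

text \<open>
  \<open>\<real>\<^sup>p\<close> is \<^term>\<open>Euclidean_space p\<close>, whose points are functions \<open>nat \<Rightarrow> real\<close> vanishing from
  index \<open>p\<close> on; this allows \<open>p = 0\<close>. A function is \<open>C\<^sup>k\<close> on an open set if all its
  iterated partial derivatives of order at most \<open>k\<close> exist there and are continuous.
\<close>

primrec Ck_on :: "nat \<Rightarrow> nat \<Rightarrow> (nat \<Rightarrow> real) set \<Rightarrow> ((nat \<Rightarrow> real) \<Rightarrow> real) \<Rightarrow> bool" where
  "Ck_on p 0 V f \<longleftrightarrow> continuous_map (subtopology (Euclidean_space p) V) euclideanreal f"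
| "Ck_on p (Suc k) V f \<longleftrightarrow>
     continuous_map (subtopology (Euclidean_space p) V) euclideanreal f \<and>
     (\<forall>i<p. \<exists>g. (\<forall>x\<in>V. ((\<lambda>t. f (x(i := t))) has_real_derivative g x) (at (x i))) \<and> Ck_on p k V g)"

definition smooth_on :: "nat \<Rightarrow> (nat \<Rightarrow> real) set \<Rightarrow> ((nat \<Rightarrow> real) \<Rightarrow> real) \<Rightarrow> bool" where
  "smooth_on p V f \<longleftrightarrow> (\<forall>k. Ck_on p k V f)"

text \<open>Functions on a set \<open>V\<close> are represented by their \<^const>\<open>extensional\<close> versions.\<close>

definition Cinf :: "nat \<Rightarrow> (nat \<Rightarrow> real) set \<Rightarrow> ((nat \<Rightarrow> real) \<Rightarrow> real) set" where
  "Cinf p V = {f \<in> extensional V. smooth_on p V f}"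

section \<open>Superdomains\<close>

text \<open>
  The formal variables are numbered from \<open>0\<close>, and \<open>ds ! a\<close> is the degree of variable \<open>a\<close>.
  A multi-index is a function \<open>nat \<Rightarrow> nat\<close> supported on the variables.
\<close>

definition variable_degrees :: "nat \<Rightarrow> nat list \<Rightarrow> bool list list \<Rightarrow> bool" where
  "variable_degrees n qs ds \<longleftrightarrow>
     length ds = sum_list qs \<and> set ds \<subseteq> Z2n n - {deg_zero n} \<and>
     (\<forall>k < 2 ^ n - 1. card {a. a < length ds \<and> ds ! a = nonzero_degs n ! k} = qs ! k)"

definition multi_indices :: "nat \<Rightarrow> bool list list \<Rightarrow> (nat \<Rightarrow> nat) set" where
  "multi_indices n ds =
     {\<mu>. (\<forall>a \<ge> length ds. \<mu> a = 0) \<and>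
          (\<forall>a < length ds. odd (deg_pairing n (ds ! a) (ds ! a)) \<longrightarrow> \<mu> a \<le> 1)}"

definition monomial_degree :: "nat \<Rightarrow> bool list list \<Rightarrow> (nat \<Rightarrow> nat) \<Rightarrow> bool list" where
  "monomial_degree n ds \<mu> =
     map (\<lambda>k. odd (\<Sum>a<length ds. \<mu> a * of_bool (ds ! a ! k))) [0..<n]"

text \<open>
  With \<open>\<xi>\<^sup>\<mu>\<close> the product of the powers of the variables in increasing order, one has
  \<open>\<xi>\<^sup>\<alpha> \<xi>\<^sup>\<beta> = \<plusminus> \<xi>\<^sup>\<alpha>\<^sup>+\<^sup>\<beta>\<close>; the sign comes from moving each factor \<open>a\<close> of \<open>\<xi>\<^sup>\<alpha>\<close> past each
  factor \<open>b < a\<close> of \<open>\<xi>\<^sup>\<beta>\<close>. If \<open>\<alpha> + \<beta>\<close> is not in \<^const>\<open>multi_indices\<close>, the product is zero.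
\<close>

definition monomial_sign ::
    "nat \<Rightarrow> bool list list \<Rightarrow> (nat \<Rightarrow> nat) \<Rightarrow> (nat \<Rightarrow> nat) \<Rightarrow> real" where
  "monomial_sign n ds \<alpha> \<beta> =
     (-1) ^ (\<Sum>a<length ds. \<Sum>b<a. \<alpha> a * \<beta> b * deg_pairing n (ds ! a) (ds ! b))"

definition power_series_algebra ::
    "nat \<Rightarrow> nat \<Rightarrow> bool list list \<Rightarrow> (nat \<Rightarrow> real) set \<Rightarrow>
     ((nat \<Rightarrow> nat) \<Rightarrow> (nat \<Rightarrow> real) \<Rightarrow> real) graded" where
  "power_series_algebra n p ds V =
     \<lparr>carrier = (\<Pi>\<^sub>E \<mu>\<in>multi_indices n ds. Cinf p V),
      mult = (\<lambda>f g. \<lambda>\<mu>\<in>multi_indices n ds. \<lambda>x\<in>V.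
        \<Sum>\<alpha> | \<forall>a. \<alpha> a \<le> \<mu> a.
          monomial_sign n ds \<alpha> (\<lambda>a. \<mu> a - \<alpha> a) * f \<alpha> x * g (\<lambda>a. \<mu> a - \<alpha> a) x),
      one = (\<lambda>\<mu>\<in>multi_indices n ds. \<lambda>x\<in>V. if \<mu> = (\<lambda>_. 0) then 1 else 0),
      zero = (\<lambda>\<mu>\<in>multi_indices n ds. \<lambda>x\<in>V. 0),
      add = (\<lambda>f g. \<lambda>\<mu>\<in>multi_indices n ds. \<lambda>x\<in>V. f \<mu> x + g \<mu> x),
      smult = (\<lambda>r f. \<lambda>\<mu>\<in>multi_indices n ds. \<lambda>x\<in>V. r * f \<mu> x),
      homog = (\<lambda>i. {f \<in> (\<Pi>\<^sub>E \<mu>\<in>multi_indices n ds. Cinf p V).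
        \<forall>\<mu>\<in>multi_indices n ds. monomial_degree n ds \<mu> \<noteq> i \<longrightarrow> f \<mu> = (\<lambda>x\<in>V. 0)})\<rparr>"

definition superdomain ::
    "nat \<Rightarrow> nat \<Rightarrow> bool list list \<Rightarrow> (nat \<Rightarrow> real) set \<Rightarrow>
     (nat \<Rightarrow> real, (nat \<Rightarrow> nat) \<Rightarrow> (nat \<Rightarrow> real) \<Rightarrow> real) ringed_space" where
  "superdomain n p ds D =
     \<lparr>base = subtopology (Euclidean_space p) D,
      sect = power_series_algebra n p ds,
      restr = (\<lambda>V W f. \<lambda>\<mu>\<in>multi_indices n ds. restrict (f \<mu>) W)\<rparr>"

section \<open>Supermanifolds\<close>

definition supermanifold :: "nat \<Rightarrow> nat \<Rightarrow> nat list \<Rightarrow> ('m, 'a) ringed_space \<Rightarrow> bool" where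
  "supermanifold n p qs M \<longleftrightarrow>
     locally_ringed_space n M \<and>
     (\<forall>m\<in>topspace (base M). \<exists>U ds D.
        openin (base M) U \<and> m \<in> U \<and> variable_degrees n qs ds \<and> openin (Euclidean_space p) D \<and>
        lrs_isomorphic n (open_subspace M U) (superdomain n p ds D))"

definition base_projection :: "('m, 'a) ringed_space \<Rightarrow> 'm set \<Rightarrow> 'a \<Rightarrow> 'm \<Rightarrow> real" where
  "base_projection M U f = (\<lambda>m\<in>U. THE k. \<forall>W. openin (base M) W \<and> m \<in> W \<and> W \<subseteq> U \<longrightarrow>
     restr M U W (f \<ominus>\<^bsub>sect M U\<^esub> (k \<odot>\<^bsub>sect M U\<^esub> \<one>\<^bsub>sect M U\<^esub>)) \<notin> Units (sect M W))"

definition base_kernel :: "('m, 'a) ringed_space \<Rightarrow> 'm set \<Rightarrow> 'a set" where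
  "base_kernel M U = {f \<in> carrier (sect M U). base_projection M U f = (\<lambda>m\<in>U. 0)}"

definition kernel_sheaf :: "('m, 'a) ringed_space \<Rightarrow> ('m, 'a) ringed_space" where
  "kernel_sheaf M = M\<lparr>sect := (\<lambda>U. (sect M U)
     \<lparr>carrier := base_kernel M U, homog := (\<lambda>i. homog (sect M U) i \<inter> base_kernel M U)\<rparr>)\<rparr>"

section \<open>Smooth manifolds\<close>

text \<open>A smooth structure is given by an atlas, a set of charts (domain, coordinate map).\<close>

definition smooth_manifold ::
    "nat \<Rightarrow> 'm topology \<Rightarrow> ('m set \<times> ('m \<Rightarrow> nat \<Rightarrow> real)) set \<Rightarrow> bool" where
  "smooth_manifold p X \<C> \<longleftrightarrow>
     Hausdorff_space X \<and> second_countable X \<and>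
     (\<forall>(U, \<phi>)\<in>\<C>. openin X U \<and> openin (Euclidean_space p) (\<phi> ` U) \<and>
        homeomorphic_map (subtopology X U) (subtopology (Euclidean_space p) (\<phi> ` U)) \<phi>) \<and>
     topspace X = (\<Union>(U, \<phi>)\<in>\<C>. U) \<and>
     (\<forall>(U, \<phi>)\<in>\<C>. \<forall>(V, \<psi>)\<in>\<C>. \<forall>i<p. smooth_on p (\<phi> ` (U \<inter> V)) (\<lambda>x. \<psi> (inv_into U \<phi> x) i))"

definition smooth_functions ::
    "nat \<Rightarrow> ('m set \<times> ('m \<Rightarrow> nat \<Rightarrow> real)) set \<Rightarrow> 'm set \<Rightarrow> ('m \<Rightarrow> real) set" where
  "smooth_functions p \<C> U =
     {f \<in> extensional U. \<forall>(V, \<phi>)\<in>\<C>. smooth_on p (\<phi> ` (U \<inter> V)) (\<lambda>x. f (inv_into V \<phi> x))}"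

text \<open>Smooth functions are homogeneous of degree zero.\<close>

definition smooth_function_sheaf ::
    "nat \<Rightarrow> nat \<Rightarrow> 'm topology \<Rightarrow> ('m set \<times> ('m \<Rightarrow> nat \<Rightarrow> real)) set \<Rightarrow>
     ('m, 'm \<Rightarrow> real) ringed_space" where
  "smooth_function_sheaf n p X \<C> =
     \<lparr>base = X,
      sect = (\<lambda>U.
        \<lparr>carrier = smooth_functions p \<C> U,
         mult = (\<lambda>f g. \<lambda>m\<in>U. f m * g m),
         one = (\<lambda>m\<in>U. 1),
         zero = (\<lambda>m\<in>U. 0),
         add = (\<lambda>f g. \<lambda>m\<in>U. f m + g m),
         smult = (\<lambda>r f. \<lambda>m\<in>U. r * f m),
         homog = (\<lambda>i. if i = deg_zero n then smooth_functions p \<C> U else {\<lambda>m\<in>U. 0})\<rparr>),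
      restr = (\<lambda>U V f. restrict f V)\<rparr>"

section \<open>Exact sequences of sheaves\<close>

definition graded_sheaf_morphism ::
    "nat \<Rightarrow> ('m, 'a) ringed_space \<Rightarrow> ('m, 'b) ringed_space \<Rightarrow> ('m set \<Rightarrow> 'a \<Rightarrow> 'b) \<Rightarrow> bool" where
  "graded_sheaf_morphism n F G h \<longleftrightarrow>
     base F = base G \<and>
     (\<forall>U. openin (base F) U \<longrightarrow> graded_linear n (sect F U) (sect G U) (h U)) \<and>
     (\<forall>U V. openin (base F) U \<and> openin (base F) V \<and> V \<subseteq> U \<longrightarrow>
        (\<forall>f\<in>carrier (sect F U). h V (restr F U V f) = restr G U V (h U f)))"

definition algebra_sheaf_morphism ::
    "nat \<Rightarrow> ('m, 'a) ringed_space \<Rightarrow> ('m, 'b) ringed_space \<Rightarrow> ('m set \<Rightarrow> 'a \<Rightarrow> 'b) \<Rightarrow> bool" where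
  "algebra_sheaf_morphism n F G h \<longleftrightarrow>
     graded_sheaf_morphism n F G h \<and>
     (\<forall>U. openin (base F) U \<longrightarrow> graded_algebra_hom n (sect F U) (sect G U) (h U))"

text \<open>
  Exactness of \<open>0 \<rightarrow> F \<rightarrow> G \<rightarrow> H \<rightarrow> 0\<close> as sheaves is exactness on all stalks. In particular
  \<open>G U \<rightarrow> H U\<close> need not be surjective.
\<close>

definition short_exact_sequence ::
    "nat \<Rightarrow> ('m, 'a) ringed_space \<Rightarrow> ('m, 'b) ringed_space \<Rightarrow> ('m, 'c) ringed_space \<Rightarrow>
     ('m set \<Rightarrow> 'a \<Rightarrow> 'b) \<Rightarrow> ('m set \<Rightarrow> 'b \<Rightarrow> 'c) \<Rightarrow> bool" where
  "short_exact_sequence n F G H \<alpha> \<beta> \<longleftrightarrow>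
     graded_sheaf n F \<and> graded_sheaf n G \<and> graded_sheaf n H \<and>
     graded_sheaf_morphism n F G \<alpha> \<and> graded_sheaf_morphism n G H \<beta> \<and>
     (\<forall>m\<in>topspace (base G).
        {a \<in> carrier (stalk F m). stalk_map G (\<lambda>x. x) \<alpha> m a = \<zero>\<^bsub>stalk G m\<^esub>} = {\<zero>\<^bsub>stalk F m\<^esub>} \<and>
        stalk_map G (\<lambda>x. x) \<alpha> m ` carrier (stalk F m) =
          {b \<in> carrier (stalk G m). stalk_map H (\<lambda>x. x) \<beta> m b = \<zero>\<^bsub>stalk H m\<^esub>} \<and>
        stalk_map H (\<lambda>x. x) \<beta> m ` carrier (stalk G m) = carrier (stalk H m))"

end

theory Submission
  imports Defs
begin

text \<open>
  In a superdomain a section is invertible exactly where its body, the coefficient of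
  \<open>\<xi>\<^sup>0\<close>, does not vanish: a right inverse is found by recursion on the degree. Hence in a chart
  \<open>\<epsilon> f\<close> is the body of \<open>f\<close>, which gives at once that \<open>\<epsilon>\<close> is a morphism of algebras, that it
  kills sections of nonzero degree, and that it is locally surjective. The base maps of the
  superdomain charts form a smooth atlas, because the coordinate functions of one chart lift to
  sections, and the base projection of a section is smooth in every other chart.
\<close>

section \<open>Smooth functions\<close>

text \<open>Smoothness is given by iterated partial derivatives, so composing smooth maps would call
  for a chain rule in several variables. The proof avoids composition:
  \<open>base_projection\<close> refers to no chart, so one and the same section can be read in two
  charts, and each reading is a coefficient of a power series, smooth by definition of the
  superdomain. Invertibility has to be characterized over every small open set, because \<epsilon>
  is defined by its failure in all neighborhoods of a point; continuity of the body then singles out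
  the value. Two more demands come from the conclusion. The kernel must be a sheaf of graded spaces,
  so the homogeneous components of a kernel element have to lie in the kernel again; and exactness
  concerns germs, which permits shrinking to a chart domain before lifting a function.\<close>

definition has_partial :: "nat \<Rightarrow> (nat \<Rightarrow> real) set \<Rightarrow> ((nat \<Rightarrow> real) \<Rightarrow> real) \<Rightarrow> ((nat \<Rightarrow> real) \<Rightarrow> real) \<Rightarrow> bool" where
  "has_partial i V f g \<longleftrightarrow> (\<forall>x\<in>V. ((\<lambda>t. f (x(i := t))) has_real_derivative g x) (at (x i)))"

lemma has_partialD: "has_partial i V f g \<Longrightarrow> x \<in> V \<Longrightarrow> ((\<lambda>t. f (x(i := t))) has_real_derivative g x) (at (x i))"
  by (simp add: has_partial_def)

lemma has_partialI:
  "(\<And>x. x \<in> V \<Longrightarrow> ((\<lambda>t. f (x(i := t))) has_real_derivative g x) (at (x i))) \<Longrightarrow> has_partial i V f g"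
  unfolding has_partial_def by (rule ballI)

text \<open>The clause about derivatives is folded into \<open>has_partial\<close>, so that a
  derivative and its property travel as one fact. From here on this replaces the defining equation
  in the successor case.\<close>

lemma Ck_on_Suc_iff:
  "Ck_on p (Suc k) V f \<longleftrightarrow> continuous_map (subtopology (Euclidean_space p) V) euclideanreal f \<and>
    (\<forall>i<p. \<exists>g. has_partial i V f g \<and> Ck_on p k V g)"
  unfolding has_partial_def by simp

declare Ck_on.simps(2) [simp del]

section \<open>Order, domain and locality of the C^k conditions\<close>

lemma Ck_on_continuous:
  "Ck_on p k V f \<Longrightarrow> continuous_map (subtopology (Euclidean_space p) V) euclideanreal f"
  by (cases k) (auto simp: Ck_on_Suc_iff)

lemma Ck_on_SucD: "Ck_on p (Suc k) V f \<Longrightarrow> Ck_on p k V f"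
proof (induction k arbitrary: f)
  case 0
  then show ?case by (simp add: Ck_on_continuous)
next
  case (Suc k)
  then show ?case
    unfolding Ck_on_Suc_iff[of p "Suc k"] Ck_on_Suc_iff[of p k] by blast
qed

lemma Ck_on_subset:
  assumes "W \<subseteq> V" "Ck_on p k V f"
  shows "Ck_on p k W f"
  using assms(2)
proof (induction k arbitrary: f)
  case 0
  then show ?case
    using assms(1) continuous_map_from_subtopology_mono by auto
next
  case (Suc k)
  have "continuous_map (subtopology (Euclidean_space p) W) euclideanreal f"
    using Ck_on_continuous[OF Suc.prems] assms(1) by (rule continuous_map_from_subtopology_mono)
  moreover have "has_partial i W f g" if "has_partial i V f g" for i g
    using that assms(1) by (auto simp: has_partial_def)
  ultimately show ?case
    using Suc unfolding Ck_on_Suc_iff by blast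
qed

text \<open>The derivative at \<open>x\<close> involves only points \<open>x(i := t)\<close> with
  \<open>t\<close> near \<open>x i\<close>. These stay in the open set \<open>V\<close>, because the
  line is a continuous map into \<open>Euclidean_space p\<close>: for \<open>i < p\<close> the
  coordinates from \<open>p\<close> on remain zero.\<close>

lemma has_partial_cong:
  assumes V: "openin (Euclidean_space p) V" and i: "i < p"
    and fg: "\<And>y. y \<in> V \<Longrightarrow> f y = g y" and f: "has_partial i V f h"
  shows "has_partial i V g h"
proof (rule has_partialI)
  fix x assume x: "x \<in> V"
  have xE: "x \<in> topspace (Euclidean_space p)"
    using V x openin_subset by blast
  have "continuous_map euclideanreal (powertop_real UNIV) (\<lambda>t. x(i := t))"
    unfolding continuous_map_componentwise_UNIV by (simp add: fun_upd_def)
  then have "continuous_map euclideanreal (Euclidean_space p) (\<lambda>t. x(i := t))"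
    using xE i unfolding Euclidean_space_def continuous_map_in_subtopology by auto
  then have "open {t. x(i := t) \<in> V}"
    using openin_continuous_map_preimage[OF _ V] by fastforce
  moreover have "x i \<in> {t. x(i := t) \<in> V}" using x by simp
  ultimately show "((\<lambda>t. g (x(i := t))) has_real_derivative h x) (at (x i))"
    using fg by (intro has_field_derivative_transform_within_open[OF has_partialD[OF f x]]) auto
qed

text \<open>A partial derivative of \<open>f\<close> is also one of \<open>g\<close>, so only the
  outermost function is exchanged and no induction on \<open>k\<close> arises.\<close>

lemma Ck_on_cong:
  assumes V: "openin (Euclidean_space p) V" and fg: "\<And>x. x \<in> V \<Longrightarrow> f x = g x"
    and f: "Ck_on p k V f"
  shows "Ck_on p k V g"
proof -
  have c: "continuous_map (subtopology (Euclidean_space p) V) euclideanreal g"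
    using Ck_on_continuous[OF f] fg by (auto elim: continuous_map_eq)
  show ?thesis
  proof (cases k)
    case 0
    then show ?thesis
      using c by simp
  next
    case (Suc l)
    have "has_partial i V g h" if "i < p" "has_partial i V f h" for i h
      using V that(1) fg that(2) by (rule has_partial_cong)
    then show ?thesis
      using f c unfolding Suc Ck_on_Suc_iff by blast
  qed
qed

text \<open>The members of \<V> supply their derivatives independently of each other, whereas the
  recursion asks for a single function on the union.\<close>

lemma Ck_on_Union:
  assumes op: "\<And>V. V \<in> \<V> \<Longrightarrow> openin (Euclidean_space p) V"
    and "\<And>V. V \<in> \<V> \<Longrightarrow> Ck_on p k V f"
  shows "Ck_on p k (\<Union>\<V>) f"
  using assms(2)
proof (induction k arbitrary: f)
  have cont: "continuous_map (subtopology (Euclidean_space p) (\<Union>\<V>)) euclideanreal f"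
    if f: "\<And>V. V \<in> \<V> \<Longrightarrow> continuous_map (subtopology (Euclidean_space p) V) euclideanreal f" for f
  proof (rule pasting_lemma[where I = \<V> and T = "\<lambda>V. V" and f = "\<lambda>_. f"])
    show "openin (subtopology (Euclidean_space p) (\<Union>\<V>)) V" if "V \<in> \<V>" for V
      using op that by (meson Sup_upper openin_subtopology_refl openin_open_subtopology openin_Union)
    show "continuous_map (subtopology (subtopology (Euclidean_space p) (\<Union>\<V>)) V) euclideanreal f"
      if "V \<in> \<V>" for V
      using f[OF that] that
      by (metis Sup_upper inf.absorb2 subtopology_subtopology)
  qed auto
  {
    case 0
    then show ?case using cont by simp
  next
    case (Suc k)
    have "\<exists>g. has_partial i (\<Union>\<V>) f g \<and> Ck_on p k (\<Union>\<V>) g" if i: "i < p" for i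
    proof -
      \<comment> \<open>Derivatives are unique, so on each member this pointwise choice equals the
        derivative which that member supplies.\<close>
      define g where "g = (\<lambda>x. SOME d. ((\<lambda>t. f (x(i := t))) has_real_derivative d) (at (x i)))"
      have *: "g x = d" if "((\<lambda>t. f (x(i := t))) has_real_derivative d) (at (x i))" for x d
        unfolding g_def using someI[of "\<lambda>d. (_ has_real_derivative d) _", OF that] that by (rule DERIV_unique)
      have "has_partial i V f g \<and> Ck_on p k V g" if V: "V \<in> \<V>" for V
      proof -
        obtain h where h: "has_partial i V f h" "Ck_on p k V h"
          using Suc.prems[OF V] i unfolding Ck_on_Suc_iff by blast
        then have gh: "h x = g x" if "x \<in> V" for x
          using *[OF has_partialD[OF _ that]] by simp
        then have "has_partial i V f g"
          using h(1) unfolding has_partial_def by simp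
        then show ?thesis using Ck_on_cong[OF op[OF V] gh h(2)] by simp
      qed
      then show ?thesis using Suc.IH[of g] unfolding has_partial_def by blast
    qed
    moreover have "continuous_map (subtopology (Euclidean_space p) (\<Union>\<V>)) euclideanreal f"
      by (rule cont) (rule Ck_on_continuous[OF Suc.prems])
    ultimately show ?case by (simp add: Ck_on_Suc_iff)
  }
qed

section \<open>Arithmetic of C^k functions\<close>

lemma Ck_on_const: "Ck_on p k V (\<lambda>x. c)"
proof (induction k arbitrary: c)
  case (Suc k)
  have "has_partial i V (\<lambda>x. c) (\<lambda>x. 0)" for i
    by (simp add: has_partial_def)
  then show ?case using Suc unfolding Ck_on_Suc_iff by auto
qed simp

lemma continuous_map_coordinate:
  "continuous_map (subtopology (Euclidean_space p) V) euclideanreal (\<lambda>x. x i)"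
  unfolding Euclidean_space_def
  by (intro continuous_map_from_subtopology continuous_map_product_projection) simp

lemma Ck_on_coordinate: "Ck_on p k V (\<lambda>x. x i)"
proof (cases k)
  case (Suc l)
  have "has_partial j V (\<lambda>x. x i) (\<lambda>_. if i = j then 1 else 0)" for j
    by (auto simp: has_partial_def)
  then show ?thesis
    using Suc continuous_map_coordinate Ck_on_const unfolding Suc Ck_on_Suc_iff by blast
qed (simp add: continuous_map_coordinate)

lemma Ck_on_add:
  assumes "Ck_on p k V f" "Ck_on p k V g"
  shows "Ck_on p k V (\<lambda>x. f x + g x)"
  using assms
proof (induction k arbitrary: f g)
  case 0
  then show ?case by (simp add: continuous_map_add)
next
  case (Suc k)
  have "\<exists>h. has_partial i V (\<lambda>x. f x + g x) h \<and> Ck_on p k V h" if i: "i < p" for i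
  proof -
    obtain f' g' where "has_partial i V f f'" "Ck_on p k V f'" "has_partial i V g g'" "Ck_on p k V g'"
      using Suc.prems i unfolding Ck_on_Suc_iff by meson
    moreover from this have "has_partial i V (\<lambda>x. f x + g x) (\<lambda>x. f' x + g' x)"
      by (auto intro!: has_partialI DERIV_add dest: has_partialD)
    ultimately show ?thesis
      using Suc.IH by blast
  qed
  moreover have "continuous_map (subtopology (Euclidean_space p) V) euclideanreal (\<lambda>x. f x + g x)"
    using Suc.prems by (intro continuous_map_add Ck_on_continuous)
  ultimately show ?case by (simp add: Ck_on_Suc_iff)
qed

lemma Ck_on_mult:
  assumes "Ck_on p k V f" "Ck_on p k V g"
  shows "Ck_on p k V (\<lambda>x. f x * g x)"
  using assms
proof (induction k arbitrary: f g)
  case 0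
  then show ?case by (simp add: continuous_map_real_mult)
next
  case (Suc k)
  have "\<exists>h. has_partial i V (\<lambda>x. f x * g x) h \<and> Ck_on p k V h" if i: "i < p" for i
  proof -
    obtain f' g' where *: "has_partial i V f f'" "Ck_on p k V f'" "has_partial i V g g'" "Ck_on p k V g'"
      using Suc.prems i unfolding Ck_on_Suc_iff by meson
    have "((\<lambda>t. f (x(i := t)) * g (x(i := t))) has_real_derivative f' x * g x + g' x * f x) (at (x i))"
      if "x \<in> V" for x
      using DERIV_mult[OF has_partialD[OF *(1) that] has_partialD[OF *(3) that]] by simp
    then have "has_partial i V (\<lambda>x. f x * g x) (\<lambda>x. f' x * g x + g' x * f x)"
      by (rule has_partialI)
    \<comment> \<open>The product rule mixes factors with derivatives, so the factors are first
      weakened from order \<open>Suc k\<close> to order \<open>k\<close>.\<close>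
    moreover have "Ck_on p k V (\<lambda>x. f' x * g x + g' x * f x)"
      using * Suc.prems[THEN Ck_on_SucD] by (intro Ck_on_add Suc.IH)
    ultimately show ?thesis by blast
  qed
  moreover have "continuous_map (subtopology (Euclidean_space p) V) euclideanreal (\<lambda>x. f x * g x)"
    using Suc.prems by (intro continuous_map_real_mult Ck_on_continuous)
  ultimately show ?case by (simp add: Ck_on_Suc_iff)
qed

text \<open>The derivative of a reciprocal is a product containing that reciprocal, whose order
  \<open>k\<close> is the induction hypothesis; \<open>f\<close> therefore stays fixed. The sign is
  kept as a factor \<open>- 1\<close>, so that products and constants cover the whole
  expression.\<close>

lemma Ck_on_inverse:
  assumes nz: "\<And>x. x \<in> V \<Longrightarrow> f x \<noteq> 0" and "Ck_on p k V f"
  shows "Ck_on p k V (\<lambda>x. inverse (f x))"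
  using assms(2)
proof (induction k)
  case 0
  then show ?case using nz by (auto intro!: continuous_map_real_inverse)
next
  case (Suc k)
  have IH: "Ck_on p k V (\<lambda>x. inverse (f x))"
    using Suc Ck_on_SucD by blast
  have "\<exists>h. has_partial i V (\<lambda>x. inverse (f x)) h \<and> Ck_on p k V h" if i: "i < p" for i
  proof -
    obtain f' where f': "has_partial i V f f'" "Ck_on p k V f'"
      using Suc.prems i unfolding Ck_on_Suc_iff by blast
    have "((\<lambda>t. inverse (f (x(i := t)))) has_real_derivative (- 1) * ((inverse (f x) * f' x) * inverse (f x))) (at (x i))"
      if "x \<in> V" for x
      using DERIV_inverse'[OF has_partialD[OF f'(1) that]] nz[OF that] by simp
    then have "has_partial i V (\<lambda>x. inverse (f x)) (\<lambda>x. (- 1) * ((inverse (f x) * f' x) * inverse (f x)))"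
      by (rule has_partialI)
    moreover have "Ck_on p k V (\<lambda>x. (- 1) * ((inverse (f x) * f' x) * inverse (f x)))"
      using f' IH by (intro Ck_on_mult Ck_on_const)
    ultimately show ?thesis by blast
  qed
  then show ?case
    using Ck_on_continuous[OF IH] by (simp add: Ck_on_Suc_iff)
qed

lemma smooth_on_subset: "W \<subseteq> V \<Longrightarrow> smooth_on p V f \<Longrightarrow> smooth_on p W f"
  unfolding smooth_on_def using Ck_on_subset by blast

lemma smooth_on_cong:
  "openin (Euclidean_space p) V \<Longrightarrow> (\<And>x. x \<in> V \<Longrightarrow> f x = g x) \<Longrightarrow> smooth_on p V f \<longleftrightarrow> smooth_on p V g"
  unfolding smooth_on_def using Ck_on_cong[of p V f g] Ck_on_cong[of p V g f] by metis

lemma smooth_on_Union: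
  "(\<And>V. V \<in> \<V> \<Longrightarrow> openin (Euclidean_space p) V) \<Longrightarrow> (\<And>V. V \<in> \<V> \<Longrightarrow> smooth_on p V f)
    \<Longrightarrow> smooth_on p (\<Union>\<V>) f"
  unfolding smooth_on_def using Ck_on_Union by blast

lemma smooth_on_const: "smooth_on p V (\<lambda>x. c)"
  unfolding smooth_on_def using Ck_on_const by blast

lemma smooth_on_coordinate: "smooth_on p V (\<lambda>x. x i)"
  unfolding smooth_on_def using Ck_on_coordinate by blast

lemma smooth_on_add: "smooth_on p V f \<Longrightarrow> smooth_on p V g \<Longrightarrow> smooth_on p V (\<lambda>x. f x + g x)"
  unfolding smooth_on_def using Ck_on_add by blast

lemma smooth_on_mult: "smooth_on p V f \<Longrightarrow> smooth_on p V g \<Longrightarrow> smooth_on p V (\<lambda>x. f x * g x)"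
  unfolding smooth_on_def using Ck_on_mult by blast

lemma smooth_on_sum: "(\<And>a. a \<in> A \<Longrightarrow> smooth_on p V (f a)) \<Longrightarrow> smooth_on p V (\<lambda>x. \<Sum>a\<in>A. f a x)"
  by (induction A rule: infinite_finite_induct) (auto intro: smooth_on_const smooth_on_add)

lemma smooth_on_inverse:
  "(\<And>x. x \<in> V \<Longrightarrow> f x \<noteq> 0) \<Longrightarrow> smooth_on p V f
    \<Longrightarrow> smooth_on p V (\<lambda>x. inverse (f x))"
  unfolding smooth_on_def using Ck_on_inverse by blast

lemma smooth_on_continuous:
  "smooth_on p V f \<Longrightarrow> continuous_map (subtopology (Euclidean_space p) V) euclideanreal f"
  unfolding smooth_on_def using Ck_on_continuous by blast

text \<open>Openness of \<open>V\<close> makes the undefined values off \<open>V\<close> invisible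
  to the derivatives.\<close>

lemma restrict_Cinf:
  assumes "openin (Euclidean_space p) V" "smooth_on p V f"
  shows "restrict f V \<in> Cinf p V"
  using assms smooth_on_cong[of p V "restrict f V" f] unfolding Cinf_def by simp

section \<open>Units of power series algebras\<close>

lemma zero_multi_index: "(\<lambda>_. 0) \<in> multi_indices n ds"
  by (simp add: multi_indices_def)

lemma le_zero_multi_index: "{\<alpha>. \<forall>a. \<alpha> a = (0::nat)} = {\<lambda>_. 0}"
  by auto

lemma finite_le_multi_index:
  assumes "\<mu> \<in> multi_indices n ds"
  shows "finite {\<alpha>. \<forall>a. \<alpha> a \<le> \<mu> a}"
proof (rule finite_subset)
  \<comment> \<open>The total degree of \<mu> bounds each of its entries, which gives one finite
    range for all variables.\<close>
  show "{\<alpha>. \<forall>a. \<alpha> a \<le> \<mu> a} \<subseteq>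
      {\<alpha>. \<forall>a. (a \<in> {..<length ds} \<longrightarrow> \<alpha> a \<in> {..\<Sum>a<length ds. \<mu> a}) \<and> (a \<notin> {..<length ds} \<longrightarrow> \<alpha> a = 0)}"
  proof (intro subsetI CollectI allI conjI impI)
    fix \<alpha> a
    assume "\<alpha> \<in> {\<alpha>. \<forall>a. \<alpha> a \<le> \<mu> a}"
    then have *: "\<alpha> a \<le> \<mu> a" by simp
    show "\<alpha> a \<in> {..\<Sum>a<length ds. \<mu> a}" if "a \<in> {..<length ds}"
      using * member_le_sum[of a "{..<length ds}" \<mu>] that by auto
    show "\<alpha> a = 0" if "a \<notin> {..<length ds}"
      using assms * that unfolding multi_indices_def by auto
  qed
  show "finite {\<alpha>. \<forall>a. (a \<in> {..<length ds} \<longrightarrow> \<alpha> a \<in> {..\<Sum>a<length ds. \<mu> a}) \<and>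
      (a \<notin> {..<length ds} \<longrightarrow> \<alpha> a = 0)}"
    by (rule finite_set_of_finite_funs) auto
qed

text \<open>Both conditions on an exponent pass to smaller exponents. Hence the Cauchy product at an
  admissible \<mu> meets admissible factors only.\<close>

lemma multi_index_le:
  assumes "\<mu> \<in> multi_indices n ds" "\<forall>a. \<alpha> a \<le> \<mu> a"
  shows "\<alpha> \<in> multi_indices n ds"
proof -
  have "\<alpha> a = 0" if "\<mu> a = 0" for a
    using assms(2)[rule_format, of a] that by simp
  moreover have "\<alpha> a \<le> 1" if "\<mu> a \<le> 1" for a
    using assms(2)[rule_format, of a] that by simp
  ultimately show ?thesis
    using assms(1) unfolding multi_indices_def by blast
qed

lemma multi_index_diff:
  "\<mu> \<in> multi_indices n ds \<Longrightarrow> (\<lambda>a. \<mu> a - \<alpha> a) \<in> multi_indices n ds"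
  by (rule multi_index_le) auto

lemma monomial_sign_zero: "monomial_sign n ds (\<lambda>_. 0) \<beta> = 1"
  by (simp add: monomial_sign_def)

text \<open>Total degree is the measure behind the termination of \<open>inverse_coeff\<close> and
  the induction for its smoothness. Entries beyond the variables are zero, so a nonzero \<alpha>
  lowers an entry that the sum counts.\<close>

lemma sum_multi_index_diff_less:
  assumes "\<mu> \<in> multi_indices n ds" "\<forall>a. \<alpha> a \<le> \<mu> a" "\<alpha> \<noteq> (\<lambda>_. 0)"
  shows "(\<Sum>a<length ds. \<mu> a - \<alpha> a) < (\<Sum>a<length ds. \<mu> a)"
proof -
  obtain a where a: "\<alpha> a \<noteq> 0" using assms(3) by auto
  then have "\<mu> a \<noteq> 0" using assms(2) by (metis le_zero_eq)
  moreover have "\<mu> a = 0" if "length ds \<le> a"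
    using assms(1) that by (simp add: multi_indices_def)
  ultimately have "a < length ds" by (rule_tac ccontr) simp
  moreover have "\<mu> a - \<alpha> a < \<mu> a" using a \<open>\<mu> a \<noteq> 0\<close> by simp
  ultimately show ?thesis
    by (intro sum_strict_mono_ex1) auto
qed

text \<open>
  The coefficients of the right inverse of a power series with coefficients \<open>c\<close>, solved
  recursively from \<open>c 0 \<cdot> g \<mu> + (\<Sum>0 \<noteq> \<alpha> \<le> \<mu>. \<plusminus> c \<alpha> \<cdot> g (\<mu> - \<alpha>)) = 1 \<mu>\<close>.
\<close>

function inverse_coeff ::
    "nat \<Rightarrow> bool list list \<Rightarrow> ((nat \<Rightarrow> nat) \<Rightarrow> real) \<Rightarrow> (nat \<Rightarrow> nat) \<Rightarrow> real" where
  "inverse_coeff n ds c \<mu> =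
     (if \<mu> \<in> multi_indices n ds then
        inverse (c (\<lambda>_. 0)) * ((if \<mu> = (\<lambda>_. 0) then 1 else 0) +
          (-1) * (\<Sum>\<alpha>\<in>{\<alpha>. \<forall>a. \<alpha> a \<le> \<mu> a} - {\<lambda>_. 0}.
            monomial_sign n ds \<alpha> (\<lambda>a. \<mu> a - \<alpha> a) * c \<alpha> * inverse_coeff n ds c (\<lambda>a. \<mu> a - \<alpha> a)))
      else 0)"
  by pat_completeness auto
termination
proof (relation "Wellfounded.measure (\<lambda>(n, ds, c, \<mu>). \<Sum>a<length ds. \<mu> a)")
  fix n ds \<mu> \<alpha> and c :: "(nat \<Rightarrow> nat) \<Rightarrow> real"
  assume "\<mu> \<in> multi_indices n ds" "\<alpha> \<in> {\<alpha>. \<forall>a. \<alpha> a \<le> \<mu> a} - {\<lambda>_. 0}"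
  then show "((n, ds, c, \<lambda>a. \<mu> a - \<alpha> a), (n, ds, c, \<mu>)) \<in>
      Wellfounded.measure (\<lambda>(n, ds, c, \<mu>). \<Sum>a<length ds. \<mu> a)"
    using sum_multi_index_diff_less[of \<mu> n ds \<alpha>] by simp
qed simp

declare inverse_coeff.simps [simp del]

lemma power_series_carrier: "carrier (power_series_algebra n p ds V) = (\<Pi>\<^sub>E \<mu>\<in>multi_indices n ds. Cinf p V)"
  by (simp add: power_series_algebra_def)

text \<open>Only the zero index lies below the zero index, and its sign is 1, so the Cauchy product
  there has a single term. The point is taken in \<open>V\<close> because coefficients are
  \<open>undefined\<close> elsewhere.\<close>

lemma power_series_zero_coeff:
  assumes "x \<in> V"
  shows "(f \<otimes>\<^bsub>power_series_algebra n p ds V\<^esub> g) (\<lambda>_. 0) x = f (\<lambda>_. 0) x * g (\<lambda>_. 0) x"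
    and "(f \<oplus>\<^bsub>power_series_algebra n p ds V\<^esub> g) (\<lambda>_. 0) x = f (\<lambda>_. 0) x + g (\<lambda>_. 0) x"
    and "(r \<odot>\<^bsub>power_series_algebra n p ds V\<^esub> g) (\<lambda>_. 0) x = r * g (\<lambda>_. 0) x"
    and "\<one>\<^bsub>power_series_algebra n p ds V\<^esub> (\<lambda>_. 0) x = 1"
  using assms zero_multi_index[of n ds]
  by (simp_all add: power_series_algebra_def le_zero_multi_index monomial_sign_zero)

text \<open>The coefficients fed to \<open>inverse_coeff\<close> vary with \<open>x\<close>, so the
  induction runs over the total degree of \<mu> instead of the recursion at a fixed coefficient
  family. Each stage uses sums, products and one reciprocal, that of the body.\<close>

lemma smooth_on_inverse_coeff:
  assumes f: "f \<in> carrier (power_series_algebra n p ds V)" and nz: "\<And>x. x \<in> V \<Longrightarrow> f (\<lambda>_. 0) x \<noteq> 0"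
  shows "smooth_on p V (\<lambda>x. inverse_coeff n ds (\<lambda>\<alpha>. f \<alpha> x) \<mu>)"
proof (induction "\<Sum>a<length ds. \<mu> a" arbitrary: \<mu> rule: less_induct)
  case less
  have sm: "smooth_on p V (\<lambda>x. f \<alpha> x)" if "\<alpha> \<in> multi_indices n ds" for \<alpha>
    using f that unfolding power_series_carrier by (auto simp: Cinf_def)
  show ?case
  proof (cases "\<mu> \<in> multi_indices n ds")
    case True
    have "smooth_on p V (\<lambda>x. inverse_coeff n ds (\<lambda>\<alpha>. f \<alpha> x) (\<lambda>a. \<mu> a - \<alpha> a))" if
      "\<alpha> \<in> {\<alpha>. \<forall>a. \<alpha> a \<le> \<mu> a} - {\<lambda>_. 0}" for \<alpha>
      using that sum_multi_index_diff_less[OF True, of \<alpha>] by (intro less) auto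
    moreover have "smooth_on p V (\<lambda>x. f \<alpha> x)" if "\<alpha> \<in> {\<alpha>. \<forall>a. \<alpha> a \<le> \<mu> a} - {\<lambda>_. 0}" for \<alpha>
      using that multi_index_le[OF True] by (intro sm) auto
    ultimately have "smooth_on p V (\<lambda>x. inverse (f (\<lambda>_. 0) x) * ((if \<mu> = (\<lambda>_. 0) then 1 else 0) +
          (-1) * (\<Sum>\<alpha>\<in>{\<alpha>. \<forall>a. \<alpha> a \<le> \<mu> a} - {\<lambda>_. 0}.
            monomial_sign n ds \<alpha> (\<lambda>a. \<mu> a - \<alpha> a) * f \<alpha> x * inverse_coeff n ds (\<lambda>\<alpha>. f \<alpha> x) (\<lambda>a. \<mu> a - \<alpha> a))))"
      using sm[OF zero_multi_index] nz
      by (intro smooth_on_mult smooth_on_add smooth_on_inverse smooth_on_const smooth_on_sum)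
    then show ?thesis
      unfolding inverse_coeff.simps[of n ds _ \<mu>] using True by simp
  next
    case False
    then show ?thesis
      unfolding inverse_coeff.simps[of n ds _ \<mu>] using smooth_on_const by simp
  qed
qed

lemma power_series_right_inverse:
  assumes V: "openin (Euclidean_space p) V"
    and f: "f \<in> carrier (power_series_algebra n p ds V)" and nz: "\<And>x. x \<in> V \<Longrightarrow> f (\<lambda>_. 0) x \<noteq> 0"
  shows "\<exists>g\<in>carrier (power_series_algebra n p ds V).
    f \<otimes>\<^bsub>power_series_algebra n p ds V\<^esub> g = \<one>\<^bsub>power_series_algebra n p ds V\<^esub>"
proof
  define g where "g = (\<lambda>\<mu>\<in>multi_indices n ds. \<lambda>x\<in>V. inverse_coeff n ds (\<lambda>\<alpha>. f \<alpha> x) \<mu>)"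
  show "g \<in> carrier (power_series_algebra n p ds V)"
    unfolding power_series_carrier g_def using restrict_Cinf[OF V smooth_on_inverse_coeff[OF f nz]] by auto
  have "(\<Sum>\<alpha> | \<forall>a. \<alpha> a \<le> \<mu> a.
        monomial_sign n ds \<alpha> (\<lambda>a. \<mu> a - \<alpha> a) * f \<alpha> x * g (\<lambda>a. \<mu> a - \<alpha> a) x)
      = (if \<mu> = (\<lambda>_. 0) then 1 else 0)" if \<mu>: "\<mu> \<in> multi_indices n ds" and x: "x \<in> V" for \<mu> x
  proof -
    let ?c = "inverse_coeff n ds (\<lambda>\<alpha>. f \<alpha> x)"
    have "(\<Sum>\<alpha> | \<forall>a. \<alpha> a \<le> \<mu> a.
        monomial_sign n ds \<alpha> (\<lambda>a. \<mu> a - \<alpha> a) * f \<alpha> x * g (\<lambda>a. \<mu> a - \<alpha> a) x)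
      = (\<Sum>\<alpha> | \<forall>a. \<alpha> a \<le> \<mu> a. monomial_sign n ds \<alpha> (\<lambda>a. \<mu> a - \<alpha> a) * f \<alpha> x * ?c (\<lambda>a. \<mu> a - \<alpha> a))"
      using multi_index_diff[OF \<mu>] x by (simp add: g_def)
    \<comment> \<open>The summand with zero \<alpha> holds the highest unknown coefficient. The
      recursion was solved for this summand, so inserting it cancels the remaining sum.\<close>
    also have "\<dots> = f (\<lambda>_. 0) x * ?c \<mu> + (\<Sum>\<alpha>\<in>{\<alpha>. \<forall>a. \<alpha> a \<le> \<mu> a} - {\<lambda>_. 0}.
          monomial_sign n ds \<alpha> (\<lambda>a. \<mu> a - \<alpha> a) * f \<alpha> x * ?c (\<lambda>a. \<mu> a - \<alpha> a))"
      by (subst sum.remove[OF finite_le_multi_index[OF \<mu>], of "\<lambda>_. 0"]) (auto simp: monomial_sign_zero)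
    also have "f (\<lambda>_. 0) x * ?c \<mu> = (if \<mu> = (\<lambda>_. 0) then 1 else 0) +
          (-1) * (\<Sum>\<alpha>\<in>{\<alpha>. \<forall>a. \<alpha> a \<le> \<mu> a} - {\<lambda>_. 0}.
            monomial_sign n ds \<alpha> (\<lambda>a. \<mu> a - \<alpha> a) * f \<alpha> x * ?c (\<lambda>a. \<mu> a - \<alpha> a))"
      using \<mu> nz[OF x] by (subst inverse_coeff.simps) (simp flip: mult.assoc)
    finally show ?thesis by simp
  qed
  then have "(\<lambda>\<mu>\<in>multi_indices n ds. \<lambda>x\<in>V. \<Sum>\<alpha> | \<forall>a. \<alpha> a \<le> \<mu> a.
        monomial_sign n ds \<alpha> (\<lambda>a. \<mu> a - \<alpha> a) * f \<alpha> x * g (\<lambda>a. \<mu> a - \<alpha> a) x)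
      = (\<lambda>\<mu>\<in>multi_indices n ds. \<lambda>x\<in>V. if \<mu> = (\<lambda>_. 0) then 1 else 0)"
    by (intro restrict_ext)
  then show "f \<otimes>\<^bsub>power_series_algebra n p ds V\<^esub> g = \<one>\<^bsub>power_series_algebra n p ds V\<^esub>"
    by (simp only: power_series_algebra_def monoid.simps ring.simps)
qed

text \<open>A right inverse \<open>g\<close> of \<open>f\<close> has nonvanishing body as well, so
  it has a right inverse \<open>h\<close> in turn. By associativity \<open>f\<close> equals
  \<open>h\<close>, and \<open>g\<close> inverts \<open>f\<close> on both sides. Conversely, the
  bodies of two inverse series multiply to 1.\<close>

lemma power_series_Units_iff:
  assumes V: "openin (Euclidean_space p) V" and m: "monoid (power_series_algebra n p ds V)"
    and f: "f \<in> carrier (power_series_algebra n p ds V)"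
  shows "f \<in> Units (power_series_algebra n p ds V) \<longleftrightarrow> (\<forall>x\<in>V. f (\<lambda>_. 0) x \<noteq> 0)"
proof -
  interpret monoid "power_series_algebra n p ds V" by (rule m)
  have nz: "g (\<lambda>_. 0) x * h (\<lambda>_. 0) x = 1"
    if "g \<otimes>\<^bsub>power_series_algebra n p ds V\<^esub> h = \<one>\<^bsub>power_series_algebra n p ds V\<^esub>" "x \<in> V" for g h x
    using power_series_zero_coeff(1)[OF that(2), of n p ds g h] that power_series_zero_coeff(4)[OF that(2), of n p ds]
    by simp
  show ?thesis
  proof
    assume "f \<in> Units (power_series_algebra n p ds V)"
    then show "\<forall>x\<in>V. f (\<lambda>_. 0) x \<noteq> 0"
      using nz[of f] unfolding Units_def by fastforce
  next
    assume *: "\<forall>x\<in>V. f (\<lambda>_. 0) x \<noteq> 0"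
    obtain g where g: "g \<in> carrier (power_series_algebra n p ds V)"
      "f \<otimes>\<^bsub>power_series_algebra n p ds V\<^esub> g = \<one>\<^bsub>power_series_algebra n p ds V\<^esub>"
      using power_series_right_inverse[OF V f] * by blast
    then have "g (\<lambda>_. 0) x \<noteq> 0" if "x \<in> V" for x
      using nz[OF g(2) that] by auto
    then obtain h where h: "h \<in> carrier (power_series_algebra n p ds V)"
      "g \<otimes>\<^bsub>power_series_algebra n p ds V\<^esub> h = \<one>\<^bsub>power_series_algebra n p ds V\<^esub>"
      using power_series_right_inverse[OF V g(1)] by blast
    have "f = h"
      using f g h by (metis l_one m_assoc r_one)
    then show "f \<in> Units (power_series_algebra n p ds V)"
      using f g h unfolding Units_def by blast
  qed
qed

section \<open>Graded algebra homomorphisms\<close>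

lemma graded_linearD:
  assumes "graded_linear n A B h"
  shows "x \<in> carrier A \<Longrightarrow> h x \<in> carrier B"
    and "x \<in> carrier A \<Longrightarrow> y \<in> carrier A \<Longrightarrow> h (x \<oplus>\<^bsub>A\<^esub> y) = h x \<oplus>\<^bsub>B\<^esub> h y"
    and "x \<in> carrier A \<Longrightarrow> h (r \<odot>\<^bsub>A\<^esub> x) = r \<odot>\<^bsub>B\<^esub> h x"
    and "i \<in> Z2n n \<Longrightarrow> x \<in> homog A i \<Longrightarrow> h x \<in> homog B i"
  using assms unfolding graded_linear_def by (auto simp: image_subset_iff)

lemma graded_algebra_homD:
  assumes "graded_algebra_hom n A B h"
  shows "graded_linear n A B h"
    and "x \<in> carrier A \<Longrightarrow> y \<in> carrier A \<Longrightarrow> h (x \<otimes>\<^bsub>A\<^esub> y) = h x \<otimes>\<^bsub>B\<^esub> h y"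
    and "h \<one>\<^bsub>A\<^esub> = \<one>\<^bsub>B\<^esub>"
  using assms unfolding graded_algebra_hom_def by auto

lemma graded_algebra_hom_Units:
  assumes h: "graded_algebra_hom n A B h" and x: "x \<in> Units A"
  shows "h x \<in> Units B"
proof -
  obtain y where "x \<in> carrier A" "y \<in> carrier A" "y \<otimes>\<^bsub>A\<^esub> x = \<one>\<^bsub>A\<^esub>" "x \<otimes>\<^bsub>A\<^esub> y = \<one>\<^bsub>A\<^esub>"
    using x unfolding Units_def by blast
  then have "h x \<in> carrier B" "h y \<in> carrier B" "h y \<otimes>\<^bsub>B\<^esub> h x = \<one>\<^bsub>B\<^esub>" "h x \<otimes>\<^bsub>B\<^esub> h y = \<one>\<^bsub>B\<^esub>"
    using graded_algebra_homD[OF h] graded_linearD(1)[OF graded_algebra_homD(1)[OF h]] by metis+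
  then show ?thesis unfolding Units_def by blast
qed

text \<open>
  Transports the monoid laws from the sections of a supermanifold to a power series algebra,
  so that they need not be checked on the explicit product with its signs.
\<close>

lemma monoid_of_retract:
  assumes A: "monoid A" and h: "graded_algebra_hom n B A h" and h': "graded_algebra_hom n A B h'"
    and one: "\<one>\<^bsub>B\<^esub> \<in> carrier B"
    and inv: "\<And>b. b \<in> carrier B \<Longrightarrow> h' (h b) = b"
  shows "monoid B"
proof -
  interpret A: monoid A by (rule A)
  have hc: "h b \<in> carrier A" if "b \<in> carrier B" for b
    using graded_linearD(1)[OF graded_algebra_homD(1)[OF h] that] .
  have mult: "b \<otimes>\<^bsub>B\<^esub> c = h' (h b \<otimes>\<^bsub>A\<^esub> h c)" if "b \<in> carrier B" "c \<in> carrier B" for b c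
    using that hc inv graded_algebra_homD(2)[OF h'] by metis
  have closed: "b \<otimes>\<^bsub>B\<^esub> c \<in> carrier B" if "b \<in> carrier B" "c \<in> carrier B" for b c
    unfolding mult[OF that] using that hc graded_linearD(1)[OF graded_algebra_homD(1)[OF h']] by simp
  have hmult: "h (b \<otimes>\<^bsub>B\<^esub> c) = h b \<otimes>\<^bsub>A\<^esub> h c" if "b \<in> carrier B" "c \<in> carrier B" for b c
    using that graded_algebra_homD(2)[OF h] by simp
  show ?thesis
  proof (rule monoidI)
    fix x y z assume xyz: "x \<in> carrier B" "y \<in> carrier B" "z \<in> carrier B"
    show "x \<otimes>\<^bsub>B\<^esub> y \<otimes>\<^bsub>B\<^esub> z = x \<otimes>\<^bsub>B\<^esub> (y \<otimes>\<^bsub>B\<^esub> z)"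
      using mult[OF closed[OF xyz(1,2)] xyz(3)] mult[OF xyz(1) closed[OF xyz(2,3)]] hmult xyz hc
      by (simp add: A.m_assoc)
  next
    fix x assume x: "x \<in> carrier B"
    show "\<one>\<^bsub>B\<^esub> \<otimes>\<^bsub>B\<^esub> x = x" "x \<otimes>\<^bsub>B\<^esub> \<one>\<^bsub>B\<^esub> = x"
      using mult[OF one x] mult[OF x one] graded_algebra_homD(3)[OF h] hc inv x by simp_all
  qed (use one closed in auto)
qed

text \<open>\<open>base_projection\<close> subtracts a constant, while homomorphisms are known to
  respect sums and real multiples; this trades one for the other.\<close>

lemma (in graded_space) minus_smult:
  assumes "x \<in> carrier A" "y \<in> carrier A"
  shows "x \<ominus>\<^bsub>A\<^esub> r \<odot>\<^bsub>A\<^esub> y = x \<oplus>\<^bsub>A\<^esub> (- r) \<odot>\<^bsub>A\<^esub> y"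
proof -
  have "\<ominus>\<^bsub>real_ring\<^esub> r = - r"
    by (rule R.minus_equality) (simp_all add: real_ring_def)
  then show ?thesis
    using smult_l_minus[of r y] assms by (simp add: a_minus_def real_ring_def)
qed

lemma (in graded_space) zero_smult: "x \<in> carrier A \<Longrightarrow> 0 \<odot> x = \<zero>"
  using smult_l_null[of x] by (simp add: real_ring_def)

text \<open>\<open>graded_linear\<close> speaks of sums and multiples only. The zero vector is
  recovered as its own multiple by 0.\<close>

lemma graded_linear_zero:
  assumes "graded_space n A" "graded_space n B" "graded_linear n A B h"
  shows "h \<zero>\<^bsub>A\<^esub> = \<zero>\<^bsub>B\<^esub>"
proof -
  interpret A: graded_space n A by fact
  interpret B: graded_space n B by fact
  have "h \<zero>\<^bsub>A\<^esub> = h (0 \<odot>\<^bsub>A\<^esub> \<zero>\<^bsub>A\<^esub>)" by (simp add: A.zero_smult)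
  also have "\<dots> = 0 \<odot>\<^bsub>B\<^esub> h \<zero>\<^bsub>A\<^esub>" using graded_linearD(3)[OF assms(3)] by simp
  also have "\<dots> = \<zero>\<^bsub>B\<^esub>" using graded_linearD(1)[OF assms(3)] by (simp add: B.zero_smult)
  finally show ?thesis .
qed

section \<open>Germs and exactness on stalks\<close>

text \<open>Germs are treated without a product, because the kernel of \<epsilon> is claimed to be a
  sheaf of graded spaces only and has to obey the same lemmas as the two sheaves of
  algebras.\<close>

locale sheaf_of_graded_spaces =
  fixes n :: nat and F :: "('m, 'a) ringed_space"
  assumes graded_sheaf: "graded_sheaf n F"
begin

abbreviation "opn \<equiv> openin (base F)"

lemma sect_space: "opn U \<Longrightarrow> graded_space n (sect F U)"
  using graded_sheaf by (simp add: graded_sheaf_def)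

lemma restr_linear: "opn U \<Longrightarrow> opn V \<Longrightarrow> V \<subseteq> U \<Longrightarrow> graded_linear n (sect F U) (sect F V) (restr F U V)"
  using graded_sheaf by (simp add: graded_sheaf_def)

lemma restr_closed: "opn U \<Longrightarrow> opn V \<Longrightarrow> V \<subseteq> U \<Longrightarrow> f \<in> carrier (sect F U) \<Longrightarrow> restr F U V f \<in> carrier (sect F V)"
  using graded_linearD(1)[OF restr_linear] .

lemma restr_self: "opn U \<Longrightarrow> f \<in> carrier (sect F U) \<Longrightarrow> restr F U U f = f"
  using graded_sheaf by (simp add: graded_sheaf_def)

lemma restr_restr:
  "opn U \<Longrightarrow> opn V \<Longrightarrow> opn W \<Longrightarrow> V \<subseteq> U \<Longrightarrow> W \<subseteq> V \<Longrightarrow> f \<in> carrier (sect F U)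
    \<Longrightarrow> restr F V W (restr F U V f) = restr F U W f"
  using graded_sheaf by (simp add: graded_sheaf_def)

lemma glue:
  assumes "\<And>U. U \<in> \<U> \<Longrightarrow> opn U" "\<And>U. U \<in> \<U> \<Longrightarrow> s U \<in> carrier (sect F U)"
    and "\<And>U V. U \<in> \<U> \<Longrightarrow> V \<in> \<U> \<Longrightarrow> restr F U (U \<inter> V) (s U) = restr F V (U \<inter> V) (s V)"
  shows "\<exists>!f. f \<in> carrier (sect F (\<Union>\<U>)) \<and> (\<forall>U\<in>\<U>. restr F (\<Union>\<U>) U f = s U)"
proof -
  have *: "\<forall>\<U> s. (\<forall>U\<in>\<U>. opn U \<and> s U \<in> carrier (sect F U)) \<and>
      (\<forall>U\<in>\<U>. \<forall>V\<in>\<U>. restr F U (U \<inter> V) (s U) = restr F V (U \<inter> V) (s V)) \<longrightarrow>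
      (\<exists>!f. f \<in> carrier (sect F (\<Union>\<U>)) \<and> (\<forall>U\<in>\<U>. restr F (\<Union>\<U>) U f = s U))"
    using graded_sheaf unfolding graded_sheaf_def by (elim conjE)
  show ?thesis
    using assms by (intro *[THEN spec, THEN spec, THEN mp] conjI ballI) blast+
qed

lemma germ_self: "opn U \<Longrightarrow> m \<in> U \<Longrightarrow> f \<in> carrier (sect F U) \<Longrightarrow> (U, f) \<in> germ F m U f"
  unfolding germ_def by auto

text \<open>A germ is the full set of its representatives, so the content is that agreement near
  \<open>m\<close> is an equivalence relation.\<close>

lemma germ_eq_iff:
  assumes U: "opn U" "m \<in> U" "f \<in> carrier (sect F U)" and V: "opn V" "m \<in> V" "g \<in> carrier (sect F V)"
  shows "germ F m U f = germ F m V g \<longleftrightarrow>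
    (\<exists>W. opn W \<and> m \<in> W \<and> W \<subseteq> U \<inter> V \<and> restr F U W f = restr F V W g)"
proof
  assume "germ F m U f = germ F m V g"
  then have "(V, g) \<in> germ F m U f"
    using germ_self[OF V] by simp
  then show "\<exists>W. opn W \<and> m \<in> W \<and> W \<subseteq> U \<inter> V \<and> restr F U W f = restr F V W g"
    unfolding germ_def by simp
next
  \<comment> \<open>Transitivity: two agreements are compared on the intersection of their
    neighborhoods. Exchanging the roles gives the other inclusion.\<close>
  have sub: "germ F m V g \<subseteq> germ F m U f"
    if U: "opn U" "m \<in> U" "f \<in> carrier (sect F U)" and V: "opn V" "m \<in> V" "g \<in> carrier (sect F V)"
      and W: "opn W" "m \<in> W" "W \<subseteq> U \<inter> V" "restr F U W f = restr F V W g" for U V W f g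
  proof clarify
    fix X h assume "(X, h) \<in> germ F m V g"
    then obtain Y where X: "opn X" "m \<in> X" "h \<in> carrier (sect F X)"
      and Y: "opn Y" "m \<in> Y" "Y \<subseteq> V \<inter> X" "restr F V Y g = restr F X Y h"
      unfolding germ_def by auto
    let ?Z = "W \<inter> Y"
    have Z: "opn ?Z" using W Y by blast
    have "restr F U ?Z f = restr F W ?Z (restr F U W f)"
      using U W Z by (subst restr_restr) auto
    also have "\<dots> = restr F V ?Z g"
      unfolding W(4) using V W Z by (subst restr_restr) auto
    also have "\<dots> = restr F Y ?Z (restr F V Y g)"
      using V Y Z by (subst restr_restr) auto
    also have "\<dots> = restr F X ?Z h"
      unfolding Y(4) using X Y Z by (subst restr_restr) auto
    finally show "(X, h) \<in> germ F m U f"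
      unfolding germ_def using X W Y Z by (auto intro!: exI[of _ ?Z])
  qed
  assume "\<exists>W. opn W \<and> m \<in> W \<and> W \<subseteq> U \<inter> V \<and> restr F U W f = restr F V W g"
  then obtain W where W: "opn W" "m \<in> W" "W \<subseteq> U \<inter> V" "restr F U W f = restr F V W g" by blast
  show "germ F m U f = germ F m V g"
    using sub[OF V U W(1,2) _ W(4)[symmetric]] sub[OF U V W] W(3) by blast
qed

lemma mem_germ:
  assumes "opn U" "m \<in> U" "f \<in> carrier (sect F U)" "(V, g) \<in> germ F m U f"
  shows "opn V" "m \<in> V" "g \<in> carrier (sect F V)"
    "\<exists>W. opn W \<and> m \<in> W \<and> W \<subseteq> U \<inter> V \<and> restr F U W f = restr F V W g"
  using assms unfolding germ_def by auto

lemma stalk_carrier: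
  "carrier (stalk F m) = {germ F m U f |U f. opn U \<and> m \<in> U \<and> f \<in> carrier (sect F U)}"
  by (simp add: stalk_def)

text \<open>The zero of the stalk is represented over the whole space. Restriction preserves zero,
  so any neighborhood may represent it in a local computation.\<close>

lemma stalk_zero:
  assumes U: "opn U" "m \<in> U"
  shows "\<zero>\<^bsub>stalk F m\<^esub> = germ F m U \<zero>\<^bsub>sect F U\<^esub>"
proof -
  let ?X = "topspace (base F)"
  have X: "opn ?X" "m \<in> ?X" "U \<subseteq> ?X"
    using U openin_subset by auto
  interpret X: graded_space n "sect F ?X" by (rule sect_space[OF X(1)])
  interpret U: graded_space n "sect F U" by (rule sect_space[OF U(1)])
  have "restr F ?X U \<zero>\<^bsub>sect F ?X\<^esub> = \<zero>\<^bsub>sect F U\<^esub>"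
    using graded_linear_zero X.graded_space_axioms U.graded_space_axioms restr_linear[OF X(1) U(1) X(3)] by blast
  then have "germ F m ?X \<zero>\<^bsub>sect F ?X\<^esub> = germ F m U \<zero>\<^bsub>sect F U\<^esub>"
    using germ_eq_iff[of ?X m _ U] X U restr_self[OF U(1)] by (auto intro!: exI[of _ U])
  then show ?thesis by (simp add: stalk_def)
qed

lemma germ_eq_zero_iff:
  assumes U: "opn U" "m \<in> U" "f \<in> carrier (sect F U)"
  shows "germ F m U f = \<zero>\<^bsub>stalk F m\<^esub> \<longleftrightarrow> (\<exists>W. opn W \<and> m \<in> W \<and> W \<subseteq> U \<and> restr F U W f = \<zero>\<^bsub>sect F W\<^esub>)"
proof -
  interpret U: graded_space n "sect F U" by (rule sect_space[OF U(1)])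
  have "restr F U W \<zero>\<^bsub>sect F U\<^esub> = \<zero>\<^bsub>sect F W\<^esub>" if "opn W" "W \<subseteq> U" for W
    using graded_linear_zero[OF U.graded_space_axioms sect_space[OF that(1)] restr_linear[OF U(1) that]] .
  then show ?thesis
    unfolding stalk_zero[OF U(1,2)] using germ_eq_iff[OF U U(1,2)] by auto
qed

lemma germ_restr:
  assumes "opn U" "opn V" "V \<subseteq> U" "m \<in> V" "f \<in> carrier (sect F U)"
  shows "germ F m V (restr F U V f) = germ F m U f"
  using assms germ_eq_iff[of V m "restr F U V f" U f] restr_closed[OF assms(1-3,5)] restr_self[of V]
  by (auto intro!: exI[of _ V])

end

section \<open>Maps induced on stalks\<close>

lemma graded_sheaf_morphismD:
  assumes "graded_sheaf_morphism n F G h"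
  shows "base F = base G"
    and "openin (base F) U \<Longrightarrow> graded_linear n (sect F U) (sect G U) (h U)"
    and "openin (base F) U \<Longrightarrow> openin (base F) V \<Longrightarrow> V \<subseteq> U \<Longrightarrow> f \<in> carrier (sect F U)
      \<Longrightarrow> h V (restr F U V f) = restr G U V (h U f)"
  using assms by (simp_all add: graded_sheaf_morphism_def)

text \<open>\<open>stalk_map\<close> is a union over all representatives. By naturality they all
  yield the same germ, so the union collapses. The preimage under the identity cuts with the whole
  space, which leaves open sets unchanged.\<close>

lemma stalk_map_germ:
  assumes F: "graded_sheaf n F" and G: "graded_sheaf n G" and h: "graded_sheaf_morphism n F G h"
    and U: "openin (base F) U" "m \<in> U" "f \<in> carrier (sect F U)"
  shows "stalk_map G (\<lambda>x. x) h m (germ F m U f) = germ G m U (h U f)"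
proof -
  interpret F: sheaf_of_graded_spaces n F by unfold_locales (rule F)
  interpret G: sheaf_of_graded_spaces n G by unfold_locales (rule G)
  note b = graded_sheaf_morphismD(1)[OF h] and nat = graded_sheaf_morphismD(3)[OF h]
  note cl = graded_linearD(1)[OF graded_sheaf_morphismD(2)[OF h]]
  have pre: "preimage G (\<lambda>x. x) V = V" if "F.opn V" for V
    using that openin_subset[of "base G" V] unfolding preimage_def b by auto
  have "germ G m (preimage G (\<lambda>x. x) V) (h V g) = germ G m U (h U f)" if "(V, g) \<in> germ F m U f" for V g
  proof -
    note V = F.mem_germ[OF U that]
    obtain W where W: "F.opn W" "m \<in> W" "W \<subseteq> U \<inter> V" "restr F U W f = restr F V W g" using V(4) by blast
    have "restr G U W (h U f) = restr G V W (h V g)"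
      using nat[of U W f] nat[of V W g] U V(1-3) W by auto
    then show ?thesis
      unfolding pre[OF V(1)]
      using G.germ_eq_iff[of V m "h V g" U "h U f"] U V(1-3) W cl by (auto simp: b intro!: exI[of _ W])
  qed
  then show ?thesis
    unfolding stalk_map_def using F.germ_self[OF U] by blast
qed

text \<open>Passing to germs preserves injectivity and exactness in the middle, so both may be asked
  over each open set. Surjectivity over each open set would be too strong; it is asked after
  shrinking around a point.\<close>

lemma short_exact_sequenceI:
  assumes F: "graded_sheaf n F" and G: "graded_sheaf n G" and H: "graded_sheaf n H"
    and \<alpha>: "graded_sheaf_morphism n F G \<alpha>" and \<beta>: "graded_sheaf_morphism n G H \<beta>"
    and inj: "\<And>U f. openin (base G) U \<Longrightarrow> f \<in> carrier (sect F U) \<Longrightarrow> \<alpha> U f = \<zero>\<^bsub>sect G U\<^esub> \<Longrightarrow> f = \<zero>\<^bsub>sect F U\<^esub>"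
    and exact: "\<And>U. openin (base G) U \<Longrightarrow>
      \<alpha> U ` carrier (sect F U) = {g \<in> carrier (sect G U). \<beta> U g = \<zero>\<^bsub>sect H U\<^esub>}"
    and surj: "\<And>U m h. openin (base G) U \<Longrightarrow> m \<in> U \<Longrightarrow> h \<in> carrier (sect H U) \<Longrightarrow>
      \<exists>W g. openin (base G) W \<and> m \<in> W \<and> W \<subseteq> U \<and> g \<in> carrier (sect G W) \<and> \<beta> W g = restr H U W h"
  shows "short_exact_sequence n F G H \<alpha> \<beta>"
proof -
  interpret F: sheaf_of_graded_spaces n F by unfold_locales (rule F)
  interpret G: sheaf_of_graded_spaces n G by unfold_locales (rule G)
  interpret H: sheaf_of_graded_spaces n H by unfold_locales (rule H)
  have b: "base F = base G" "base H = base G"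
    using graded_sheaf_morphismD(1)[OF \<alpha>] graded_sheaf_morphismD(1)[OF \<beta>] by auto
  note \<alpha>lin = graded_sheaf_morphismD(2)[OF \<alpha>, unfolded b] and \<alpha>nat = graded_sheaf_morphismD(3)[OF \<alpha>, unfolded b]
  note \<beta>lin = graded_sheaf_morphismD(2)[OF \<beta>] and \<beta>nat = graded_sheaf_morphismD(3)[OF \<beta>]
  note \<alpha>germ = stalk_map_germ[OF F G \<alpha>, unfolded b]
  note \<beta>germ = stalk_map_germ[OF G H \<beta>]
  have 1: "{a \<in> carrier (stalk F m). stalk_map G (\<lambda>x. x) \<alpha> m a = \<zero>\<^bsub>stalk G m\<^esub>} = {\<zero>\<^bsub>stalk F m\<^esub>}"
    if m: "m \<in> topspace (base G)" for m
  proof (intro equalityI subsetI)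
    fix a assume "a \<in> {a \<in> carrier (stalk F m). stalk_map G (\<lambda>x. x) \<alpha> m a = \<zero>\<^bsub>stalk G m\<^esub>}"
    then obtain U f where U: "G.opn U" "m \<in> U" "f \<in> carrier (sect F U)" "a = germ F m U f"
      and "stalk_map G (\<lambda>x. x) \<alpha> m a = \<zero>\<^bsub>stalk G m\<^esub>"
      unfolding F.stalk_carrier b by blast
    then have "germ G m U (\<alpha> U f) = \<zero>\<^bsub>stalk G m\<^esub>"
      using \<alpha>germ by simp
    then obtain W where W: "G.opn W" "m \<in> W" "W \<subseteq> U" "restr G U W (\<alpha> U f) = \<zero>\<^bsub>sect G W\<^esub>"
      using G.germ_eq_zero_iff[OF U(1,2) graded_linearD(1)[OF \<alpha>lin[OF U(1)] U(3)]] by blast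
    \<comment> \<open>Naturality turns vanishing near \<open>m\<close> into vanishing of
      \<open>\<alpha> W\<close> at the restricted section, to which \<open>inj\<close> applies over
      \<open>W\<close>.\<close>
    have "restr F U W f = \<zero>\<^bsub>sect F W\<^esub>"
      using inj[OF W(1) F.restr_closed] \<alpha>nat[OF U(1) W(1,3) U(3)] W U b by simp
    then show "a \<in> {\<zero>\<^bsub>stalk F m\<^esub>}"
      using F.germ_eq_zero_iff[of U m f] U W b by auto
  next
    fix a assume "a \<in> {\<zero>\<^bsub>stalk F m\<^esub>}"
    let ?X = "topspace (base G)"
    have X: "G.opn ?X" by simp
    interpret FX: graded_space n "sect F ?X" by (rule F.sect_space) (simp add: b)
    have a: "a = germ F m ?X \<zero>\<^bsub>sect F ?X\<^esub>"
      using F.stalk_zero[of ?X m] m b \<open>a \<in> _\<close> by simp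
    have "stalk_map G (\<lambda>x. x) \<alpha> m a = \<zero>\<^bsub>stalk G m\<^esub>"
      unfolding a using \<alpha>germ[OF X m FX.zero_closed] G.stalk_zero[OF X m]
        graded_linear_zero[OF FX.graded_space_axioms G.sect_space[OF X] \<alpha>lin[OF X]] by simp
    then show "a \<in> {a \<in> carrier (stalk F m). stalk_map G (\<lambda>x. x) \<alpha> m a = \<zero>\<^bsub>stalk G m\<^esub>}"
      using a X m FX.zero_closed unfolding F.stalk_carrier b by blast
  qed
  have 2: "stalk_map G (\<lambda>x. x) \<alpha> m ` carrier (stalk F m) =
      {c \<in> carrier (stalk G m). stalk_map H (\<lambda>x. x) \<beta> m c = \<zero>\<^bsub>stalk H m\<^esub>}"
    if m: "m \<in> topspace (base G)" for m
  proof (intro equalityI subsetI)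
    fix c assume "c \<in> stalk_map G (\<lambda>x. x) \<alpha> m ` carrier (stalk F m)"
    then obtain U f where U: "G.opn U" "m \<in> U" "f \<in> carrier (sect F U)"
      and c: "c = germ G m U (\<alpha> U f)"
      unfolding F.stalk_carrier b using \<alpha>germ by auto
    have *: "\<alpha> U f \<in> carrier (sect G U)" "\<beta> U (\<alpha> U f) = \<zero>\<^bsub>sect H U\<^esub>"
      using exact[OF U(1)] U(3) by auto
    then show "c \<in> {c \<in> carrier (stalk G m). stalk_map H (\<lambda>x. x) \<beta> m c = \<zero>\<^bsub>stalk H m\<^esub>}"
      using c U \<beta>germ[OF U(1,2) *(1)] H.stalk_zero[of U m] b unfolding G.stalk_carrier by auto
  next
    fix c assume "c \<in> {c \<in> carrier (stalk G m). stalk_map H (\<lambda>x. x) \<beta> m c = \<zero>\<^bsub>stalk H m\<^esub>}"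
    then obtain U g where U: "G.opn U" "m \<in> U" "g \<in> carrier (sect G U)" "c = germ G m U g"
      and "germ H m U (\<beta> U g) = \<zero>\<^bsub>stalk H m\<^esub>"
      unfolding G.stalk_carrier using \<beta>germ by auto
    then obtain W where W: "G.opn W" "m \<in> W" "W \<subseteq> U" "restr H U W (\<beta> U g) = \<zero>\<^bsub>sect H W\<^esub>"
      using H.germ_eq_zero_iff[unfolded b, OF U(1,2) graded_linearD(1)[OF \<beta>lin[OF U(1)] U(3)]] by blast
    \<comment> \<open>Vanishing of \<beta> is known only over the smaller \<open>W\<close>; a
      preimage found there still represents the given germ.\<close>
    then have "restr G U W g \<in> \<alpha> W ` carrier (sect F W)"
      using exact[OF W(1)] \<beta>nat[OF U(1) W(1,3) U(3)] G.restr_closed[OF U(1) W(1,3) U(3)] by simp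
    then obtain f where f: "f \<in> carrier (sect F W)" "restr G U W g = \<alpha> W f" by auto
    then have "c = stalk_map G (\<lambda>x. x) \<alpha> m (germ F m W f)"
      using \<alpha>germ[OF W(1,2) f(1)] G.germ_restr[OF U(1) W(1,3,2) U(3)] U(4) by simp
    then show "c \<in> stalk_map G (\<lambda>x. x) \<alpha> m ` carrier (stalk F m)"
      using f W unfolding F.stalk_carrier b by blast
  qed
  have 3: "stalk_map H (\<lambda>x. x) \<beta> m ` carrier (stalk G m) = carrier (stalk H m)"
    if m: "m \<in> topspace (base G)" for m
  proof (intro equalityI subsetI)
    fix c assume "c \<in> stalk_map H (\<lambda>x. x) \<beta> m ` carrier (stalk G m)"
    then obtain U f where "G.opn U" "m \<in> U" "f \<in> carrier (sect G U)" "c = germ H m U (\<beta> U f)"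
      unfolding G.stalk_carrier using \<beta>germ by auto
    then show "c \<in> carrier (stalk H m)"
      unfolding H.stalk_carrier b using graded_linearD(1)[OF \<beta>lin] by blast
  next
    fix c assume "c \<in> carrier (stalk H m)"
    then obtain U h where U: "G.opn U" "m \<in> U" "h \<in> carrier (sect H U)" "c = germ H m U h"
      unfolding H.stalk_carrier b by blast
    then obtain W g where W: "G.opn W" "m \<in> W" "W \<subseteq> U" "g \<in> carrier (sect G W)" "\<beta> W g = restr H U W h"
      using surj[OF U(1-3)] by blast
    then have "c = stalk_map H (\<lambda>x. x) \<beta> m (germ G m W g)"
      using \<beta>germ[OF W(1,2,4)] H.germ_restr[of U W m h] U b by simp
    then show "c \<in> stalk_map H (\<lambda>x. x) \<beta> m ` carrier (stalk G m)"
      using W unfolding G.stalk_carrier by blast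
  qed
  show ?thesis
    unfolding short_exact_sequence_def by (intro conjI ballI F G H \<alpha> \<beta> 1 2 3)
qed

section \<open>The base projection in a chart\<close>

locale sheaf_of_graded_algebras = sheaf_of_graded_spaces n F for n and F :: "('m, 'a) ringed_space" +
  assumes graded_algebra_sheaf: "graded_comm_algebra_sheaf n F"
begin

lemma sect_algebra: "opn U \<Longrightarrow> graded_comm_algebra n (sect F U)"
  using graded_algebra_sheaf by (simp add: graded_comm_algebra_sheaf_def)

lemma restr_hom: "opn U \<Longrightarrow> opn V \<Longrightarrow> V \<subseteq> U \<Longrightarrow> graded_algebra_hom n (sect F U) (sect F V) (restr F U V)"
  using graded_algebra_sheaf by (simp add: graded_comm_algebra_sheaf_def)

end

lemma sheaf_of_graded_algebrasI:
  "graded_comm_algebra_sheaf n F \<Longrightarrow> sheaf_of_graded_algebras n F"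
  by unfold_locales (simp_all add: graded_comm_algebra_sheaf_def)

lemma open_subspace_simps [simp]:
  "base (open_subspace M U) = subtopology (base M) U"
  "sect (open_subspace M U) = sect M"
  "restr (open_subspace M U) = restr M"
  by (simp_all add: open_subspace_def)

lemma superdomain_simps [simp]:
  "base (superdomain n p ds D) = subtopology (Euclidean_space p) D"
  "sect (superdomain n p ds D) = power_series_algebra n p ds"
  "restr (superdomain n p ds D) = (\<lambda>V W f. \<lambda>\<mu>\<in>multi_indices n ds. restrict (f \<mu>) W)"
  by (simp_all add: superdomain_def)

lemma lrs_morphismD:
  assumes "lrs_morphism n M N \<phi> \<psi>"
  shows "continuous_map (base M) (base N) \<phi>"
    and "openin (base N) V \<Longrightarrow> graded_algebra_hom n (sect N V) (sect M (preimage M \<phi> V)) (\<psi> V)"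
    and "openin (base N) V \<Longrightarrow> openin (base N) W \<Longrightarrow> W \<subseteq> V \<Longrightarrow> g \<in> carrier (sect N V) \<Longrightarrow>
      \<psi> W (restr N V W g) = restr M (preimage M \<phi> V) (preimage M \<phi> W) (\<psi> V g)"
  using assms by (simp_all add: lrs_morphism_def)

text \<open>Fixes the witnesses of \<open>lrs_isomorphic\<close>, so that they can be named. The
  section maps run against the base maps: \<psi> turns power series into sections, and \<psi>' turns
  sections into power series.\<close>

locale superchart = sheaf_of_graded_algebras n M
  for n :: nat and M :: "('m, 'a) ringed_space" +
  fixes p :: nat and U :: "'m set" and ds :: "bool list list" and D :: "(nat \<Rightarrow> real) set"
    and \<phi> :: "'m \<Rightarrow> nat \<Rightarrow> real" and \<psi> \<phi>' \<psi>'
  assumes open_dom: "openin (base M) U" and open_D: "openin (Euclidean_space p) D"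
    and mor: "lrs_morphism n (open_subspace M U) (superdomain n p ds D) \<phi> \<psi>"
    and mor': "lrs_morphism n (superdomain n p ds D) (open_subspace M U) \<phi>' \<psi>'"
    and base_inv: "\<forall>x\<in>topspace (base (open_subspace M U)). \<phi>' (\<phi> x) = x"
    and base_inv': "\<forall>y\<in>topspace (base (superdomain n p ds D)). \<phi> (\<phi>' y) = y"
    and sect_inv: "\<forall>V. openin (base (superdomain n p ds D)) V \<longrightarrow>
      (\<forall>g\<in>carrier (sect (superdomain n p ds D) V). \<psi>' (preimage (open_subspace M U) \<phi> V) (\<psi> V g) = g)"
    and sect_inv': "\<forall>V. openin (base (open_subspace M U)) V \<longrightarrow>
      (\<forall>f\<in>carrier (sect (open_subspace M U) V). \<psi> (preimage (superdomain n p ds D) \<phi>' V) (\<psi>' V f) = f)"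
begin

abbreviation "PS \<equiv> power_series_algebra n p ds"

section \<open>The topology of a chart\<close>

lemma top_U: "topspace (subtopology (base M) U) = U"
  using open_dom openin_subset by auto

lemma top_D: "topspace (subtopology (Euclidean_space p) D) = D"
  using open_D openin_subset by auto

lemma opn_sub: "openin (subtopology (base M) U) W \<longleftrightarrow> opn W \<and> W \<subseteq> U"
  by (rule openin_open_subtopology[OF open_dom])

lemma opn_sub_D: "openin (subtopology (Euclidean_space p) D) W \<longleftrightarrow> openin (Euclidean_space p) W \<and> W \<subseteq> D"
  by (rule openin_open_subtopology[OF open_D])

lemma cont: "continuous_map (subtopology (base M) U) (subtopology (Euclidean_space p) D) \<phi>"
  using lrs_morphismD(1)[OF mor] by simp

lemma cont': "continuous_map (subtopology (Euclidean_space p) D) (subtopology (base M) U) \<phi>'"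
  using lrs_morphismD(1)[OF mor'] by simp

lemma chart_in_D: "x \<in> U \<Longrightarrow> \<phi> x \<in> D"
  using continuous_map_image_subset_topspace[OF cont] unfolding top_U top_D by auto

lemma inv_in_U: "y \<in> D \<Longrightarrow> \<phi>' y \<in> U"
  using continuous_map_image_subset_topspace[OF cont'] unfolding top_U top_D by auto

lemma left_inv: "x \<in> U \<Longrightarrow> \<phi>' (\<phi> x) = x"
  using base_inv top_U by simp

lemma right_inv: "y \<in> D \<Longrightarrow> \<phi> (\<phi>' y) = y"
  using base_inv' top_D by simp

lemma chart_inj: "inj_on \<phi> U"
  using left_inv by (metis inj_onI)

lemma chart_image: "\<phi> ` U = D"
  using chart_in_D inv_in_U right_inv by force

text \<open>Morphisms index their section maps by preimages. With this fact and the next one,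
  everything is indexed by open sets of the manifold and their images under \<phi>.\<close>

lemma preimage_chart: "W \<subseteq> U \<Longrightarrow> preimage (open_subspace M U) \<phi> (\<phi> ` W) = W"
  unfolding preimage_def open_subspace_simps top_U using inj_on_image_mem_iff[OF chart_inj] by auto

lemma preimage_inv: "W \<subseteq> U \<Longrightarrow> preimage (superdomain n p ds D) \<phi>' W = \<phi> ` W"
  unfolding preimage_def superdomain_simps top_D using left_inv right_inv chart_in_D
  by (auto simp: image_iff subset_iff) metis

lemma open_image:
  assumes "opn W" "W \<subseteq> U"
  shows "openin (Euclidean_space p) (\<phi> ` W)"
proof -
  have "openin (subtopology (Euclidean_space p) D) {x \<in> D. \<phi>' x \<in> W}"
    using openin_continuous_map_preimage[OF cont', of W] assms by (simp add: opn_sub top_D del: topspace_subtopology)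
  moreover have "{x \<in> D. \<phi>' x \<in> W} = \<phi> ` W"
    using preimage_inv[OF assms(2)] unfolding preimage_def superdomain_simps top_D .
  ultimately show ?thesis by (simp add: opn_sub_D)
qed

lemma open_image_D: "opn W \<Longrightarrow> W \<subseteq> U \<Longrightarrow> openin (subtopology (Euclidean_space p) D) (\<phi> ` W)"
  using open_image chart_in_D by (auto simp: opn_sub_D)

lemma open_vimage:
  assumes "openin (Euclidean_space p) S"
  shows "opn {x \<in> U. \<phi> x \<in> S}"
proof -
  have "openin (subtopology (Euclidean_space p) D) (S \<inter> D)"
    using assms open_D by (auto simp: opn_sub_D)
  then have "openin (subtopology (base M) U) {x \<in> U. \<phi> x \<in> S \<inter> D}"
    using openin_continuous_map_preimage[OF cont, of "S \<inter> D"] by (simp add: top_U del: topspace_subtopology)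
  moreover have "{x \<in> U. \<phi> x \<in> S \<inter> D} = {x \<in> U. \<phi> x \<in> S}"
    using chart_in_D by auto
  ultimately show ?thesis by (simp add: opn_sub)
qed

lemma chart_homeomorphic: "homeomorphic_map (subtopology (base M) U) (subtopology (Euclidean_space p) (\<phi> ` U)) \<phi>"
proof -
  have "homeomorphic_maps (subtopology (base M) U) (subtopology (Euclidean_space p) D) \<phi> \<phi>'"
    unfolding homeomorphic_maps_def top_U top_D using cont cont' left_inv right_inv by simp
  then show ?thesis
    unfolding chart_image homeomorphic_map_maps by blast
qed

section \<open>Section maps of a chart and bodies of sections\<close>

lemma to_series_hom: "opn W \<Longrightarrow> W \<subseteq> U \<Longrightarrow> graded_algebra_hom n (sect M W) (PS (\<phi> ` W)) (\<psi>' W)"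
  using lrs_morphismD(2)[OF mor', of W] by (simp add: opn_sub preimage_inv)

lemma from_series_hom: "opn W \<Longrightarrow> W \<subseteq> U \<Longrightarrow> graded_algebra_hom n (PS (\<phi> ` W)) (sect M W) (\<psi> (\<phi> ` W))"
  using lrs_morphismD(2)[OF mor, of "\<phi> ` W"] by (simp add: open_image_D preimage_chart)

lemma from_to_series: "opn W \<Longrightarrow> W \<subseteq> U \<Longrightarrow> f \<in> carrier (sect M W) \<Longrightarrow> \<psi> (\<phi> ` W) (\<psi>' W f) = f"
  using sect_inv'[rule_format, of W f] by (simp add: opn_sub preimage_inv)

lemma to_from_series: "opn W \<Longrightarrow> W \<subseteq> U \<Longrightarrow> g \<in> carrier (PS (\<phi> ` W)) \<Longrightarrow> \<psi>' W (\<psi> (\<phi> ` W) g) = g"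
  using sect_inv[rule_format, of "\<phi> ` W" g] by (simp add: open_image_D preimage_chart)

lemma to_series_restr:
  "opn V \<Longrightarrow> V \<subseteq> U \<Longrightarrow> opn W \<Longrightarrow> W \<subseteq> V \<Longrightarrow> f \<in> carrier (sect M V) \<Longrightarrow>
    \<psi>' W (restr M V W f) = (\<lambda>\<mu>\<in>multi_indices n ds. restrict (\<psi>' V f \<mu>) (\<phi> ` W))"
  using lrs_morphismD(3)[OF mor', of V W f] by (simp add: opn_sub preimage_inv)

text \<open>The set is a subset of the manifold, but the value is a function of the coordinates, on
  the image of \<open>W\<close>.\<close>

definition body :: "'m set \<Rightarrow> 'a \<Rightarrow> (nat \<Rightarrow> real) \<Rightarrow> real" where
  "body W f = \<psi>' W f (\<lambda>_. 0)"

lemma to_series_closed: "opn W \<Longrightarrow> W \<subseteq> U \<Longrightarrow> f \<in> carrier (sect M W) \<Longrightarrow> \<psi>' W f \<in> carrier (PS (\<phi> ` W))"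
  using graded_linearD(1)[OF graded_algebra_homD(1)[OF to_series_hom]] .

lemma body_Cinf: "opn W \<Longrightarrow> W \<subseteq> U \<Longrightarrow> f \<in> carrier (sect M W) \<Longrightarrow> body W f \<in> Cinf p (\<phi> ` W)"
  using to_series_closed zero_multi_index unfolding body_def power_series_carrier by blast

lemma body_restr:
  "opn V \<Longrightarrow> V \<subseteq> U \<Longrightarrow> opn W \<Longrightarrow> W \<subseteq> V \<Longrightarrow> f \<in> carrier (sect M V) \<Longrightarrow>
    body W (restr M V W f) = restrict (body V f) (\<phi> ` W)"
  unfolding body_def using to_series_restr zero_multi_index by simp

lemma body_hom:
  assumes W: "opn W" "W \<subseteq> U" and x: "x \<in> \<phi> ` W" and f: "f \<in> carrier (sect M W)" and g: "g \<in> carrier (sect M W)"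
  shows "body W (f \<otimes>\<^bsub>sect M W\<^esub> g) x = body W f x * body W g x"
    and "body W (f \<oplus>\<^bsub>sect M W\<^esub> g) x = body W f x + body W g x"
    and "body W (r \<odot>\<^bsub>sect M W\<^esub> f) x = r * body W f x"
    and "body W \<one>\<^bsub>sect M W\<^esub> x = 1"
proof -
  note h = to_series_hom[OF W]
  note lin = graded_algebra_homD(1)[OF h]
  show "body W (f \<otimes>\<^bsub>sect M W\<^esub> g) x = body W f x * body W g x"
    unfolding body_def using graded_algebra_homD(2)[OF h f g] power_series_zero_coeff(1)[OF x] by simp
  show "body W (f \<oplus>\<^bsub>sect M W\<^esub> g) x = body W f x + body W g x"
    unfolding body_def using graded_linearD(2)[OF lin f g] power_series_zero_coeff(2)[OF x] by simp
  show "body W (r \<odot>\<^bsub>sect M W\<^esub> f) x = r * body W f x"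
    unfolding body_def using graded_linearD(3)[OF lin f] power_series_zero_coeff(3)[OF x] by simp
  show "body W \<one>\<^bsub>sect M W\<^esub> x = 1"
    unfolding body_def using graded_algebra_homD(3)[OF h] power_series_zero_coeff(4)[OF x] by simp
qed

lemma monomial_degree_zero: "monomial_degree n ds (\<lambda>_. 0) = deg_zero n"
  by (simp add: monomial_degree_def deg_zero_def list_eq_iff_nth_eq)

text \<open>The empty monomial has degree zero, so a homogeneous series of any other degree has no
  constant term.\<close>

lemma body_homog:
  assumes W: "opn W" "W \<subseteq> U" and i: "i \<in> Z2n n" "i \<noteq> deg_zero n"
    and f: "f \<in> homog (sect M W) i" and x: "x \<in> \<phi> ` W"
  shows "body W f x = 0"
proof -
  have "\<psi>' W f \<in> homog (PS (\<phi> ` W)) i"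
    using graded_linearD(4)[OF graded_algebra_homD(1)[OF to_series_hom[OF W]] i(1) f] .
  then have "\<psi>' W f (\<lambda>_. 0) = (\<lambda>x\<in>\<phi> ` W. 0)"
    using zero_multi_index monomial_degree_zero i(2) by (auto simp: power_series_algebra_def)
  then show ?thesis using x by (simp add: body_def)
qed

text \<open>The power series with constant term \<open>h\<close> and no further terms is carried to
  the manifold by \<psi>.\<close>

lemma body_lift:
  assumes W: "opn W" "W \<subseteq> U" and h: "h \<in> Cinf p (\<phi> ` W)"
  shows "\<exists>f\<in>carrier (sect M W). body W f = h"
proof -
  let ?g = "\<lambda>\<mu>\<in>multi_indices n ds. if \<mu> = (\<lambda>_. 0) then h else (\<lambda>x\<in>\<phi> ` W. 0)"
  have "?g \<in> carrier (PS (\<phi> ` W))"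
    unfolding power_series_carrier using h restrict_Cinf[OF open_image[OF W] smooth_on_const] by auto
  then have "\<psi> (\<phi> ` W) ?g \<in> carrier (sect M W)" "\<psi>' W (\<psi> (\<phi> ` W) ?g) = ?g"
    using graded_linearD(1)[OF graded_algebra_homD(1)[OF from_series_hom[OF W]]] to_from_series[OF W] by blast+
  then show ?thesis
    using zero_multi_index by (intro bexI[of _ "\<psi> (\<phi> ` W) ?g"]) (auto simp: body_def)
qed

text \<open>The two section maps are mutually inverse homomorphisms, so units correspond. The monoid
  laws that the criterion for series asks for are inherited from the sections.\<close>

lemma Units_iff_body:
  assumes W: "opn W" "W \<subseteq> U" and f: "f \<in> carrier (sect M W)"
  shows "f \<in> Units (sect M W) \<longleftrightarrow> (\<forall>x\<in>\<phi> ` W. body W f x \<noteq> 0)"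
proof -
  interpret A: graded_comm_algebra n "sect M W" by (rule sect_algebra[OF W(1)])
  have one: "\<one>\<^bsub>PS (\<phi> ` W)\<^esub> \<in> carrier (PS (\<phi> ` W))"
    using to_series_closed[OF W A.one_closed] graded_algebra_homD(3)[OF to_series_hom[OF W]] by simp
  have mon: "monoid (PS (\<phi> ` W))"
    using monoid_of_retract[OF A.monoid_axioms from_series_hom[OF W] to_series_hom[OF W] one to_from_series[OF W]] .
  have "f \<in> Units (sect M W) \<longleftrightarrow> \<psi>' W f \<in> Units (PS (\<phi> ` W))"
    using graded_algebra_hom_Units[OF to_series_hom[OF W], of f]
      graded_algebra_hom_Units[OF from_series_hom[OF W], of "\<psi>' W f"] from_to_series[OF W f] by auto
  then show ?thesis
    unfolding body_def using power_series_Units_iff[OF open_image[OF W] mon to_series_closed[OF W f]] by simp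
qed

text \<open>Subtracting \<open>k\<close> gives a unit over a small \<open>W\<close> exactly when the
  body avoids \<open>k\<close> on the image of \<open>W\<close>. The value of the body at
  \<open>m\<close> is met in every neighborhood; any other number is avoided in some
  neighborhood.\<close>

lemma base_projection_chart:
  assumes V: "opn V" "m \<in> V" "m \<in> U" and f: "f \<in> carrier (sect M V)"
  shows "base_projection M V f m = body (V \<inter> U) (restr M V (V \<inter> U) f) (\<phi> m)"
proof -
  define b where "b = body (V \<inter> U) (restr M V (V \<inter> U) f)"
  interpret A: graded_comm_algebra n "sect M V" by (rule sect_algebra[OF V(1)])
  let ?f = "\<lambda>k. f \<ominus>\<^bsub>sect M V\<^esub> (k \<odot>\<^bsub>sect M V\<^esub> \<one>\<^bsub>sect M V\<^esub>)"
  have smc: "k \<odot>\<^bsub>sect M V\<^esub> \<one>\<^bsub>sect M V\<^esub> \<in> carrier (sect M V)" for k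
    by (rule A.smult_closed) (simp_all add: real_ring_def)
  have f_eq: "?f k = f \<oplus>\<^bsub>sect M V\<^esub> (- k) \<odot>\<^bsub>sect M V\<^esub> \<one>\<^bsub>sect M V\<^esub>" for k
    using A.minus_smult f by simp
  have fc: "?f k \<in> carrier (sect M V)" for k
    using f smc by simp
  have VU: "opn (V \<inter> U)" using V open_dom by blast
  \<comment> \<open>Over a set inside the chart, the body of the shifted section is \<open>b\<close>
    shifted by \<open>k\<close>; existence and uniqueness both rest on this.\<close>
  have key: "restr M V W (?f k) \<in> Units (sect M W) \<longleftrightarrow> (\<forall>x\<in>\<phi> ` W. b x \<noteq> k)"
    if W: "opn W" "W \<subseteq> V \<inter> U" for W k
  proof -
    interpret W: graded_comm_algebra n "sect M W" by (rule sect_algebra[OF W(1)])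
    have WU: "W \<subseteq> U" and WV: "W \<subseteq> V" using W by auto
    have rc: "restr M V W f \<in> carrier (sect M W)"
      using restr_closed[OF V(1) W(1) WV f] .
    have smW: "(- k) \<odot>\<^bsub>sect M W\<^esub> \<one>\<^bsub>sect M W\<^esub> \<in> carrier (sect M W)"
      by (rule W.smult_closed) (simp_all add: real_ring_def)
    note h = restr_hom[OF V(1) W(1) WV]
    have r: "restr M V W (?f k) = restr M V W f \<oplus>\<^bsub>sect M W\<^esub> (- k) \<odot>\<^bsub>sect M W\<^esub> \<one>\<^bsub>sect M W\<^esub>"
      unfolding f_eq using graded_linearD(2)[OF graded_algebra_homD(1)[OF h] f smc]
        graded_linearD(3)[OF graded_algebra_homD(1)[OF h] A.one_closed] graded_algebra_homD(3)[OF h] by simp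
    have "body W (restr M V W f) = restrict b (\<phi> ` W)"
      unfolding b_def
      using body_restr[OF VU _ W(1,2) restr_closed[OF V(1) VU _ f]] restr_restr[OF V(1) VU W(1) _ W(2) f] by simp
    then have "body W (restr M V W (?f k)) x = b x - k" if "x \<in> \<phi> ` W" for x
      unfolding r using that body_hom(2)[OF W(1) WU that rc smW] body_hom(3)[OF W(1) WU that W.one_closed W.one_closed]
        body_hom(4)[OF W(1) WU that rc rc] by simp
    then show ?thesis
      using Units_iff_body[OF W(1) WU restr_closed[OF V(1) W(1) WV fc]] by simp
  qed
  have b: "b \<in> Cinf p (\<phi> ` (V \<inter> U))"
    unfolding b_def using body_Cinf[OF VU _ restr_closed[OF V(1) VU _ f]] by simp
  have "(THE k. \<forall>W. opn W \<and> m \<in> W \<and> W \<subseteq> V \<longrightarrow> restr M V W (?f k) \<notin> Units (sect M W)) = b (\<phi> m)"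
  proof (rule the_equality)
    show "\<forall>W. opn W \<and> m \<in> W \<and> W \<subseteq> V \<longrightarrow> restr M V W (?f (b (\<phi> m))) \<notin> Units (sect M W)"
    proof (intro allI impI notI, elim conjE)
      fix W assume W: "opn W" "m \<in> W" "W \<subseteq> V" and u: "restr M V W (?f (b (\<phi> m))) \<in> Units (sect M W)"
      have WU: "opn (W \<inter> U)" using W open_dom by blast
      have "restr M W (W \<inter> U) (restr M V W (?f (b (\<phi> m)))) \<in> Units (sect M (W \<inter> U))"
        by (rule graded_algebra_hom_Units[OF restr_hom[OF W(1) WU] u]) simp
      then have "restr M V (W \<inter> U) (?f (b (\<phi> m))) \<in> Units (sect M (W \<inter> U))"
        using restr_restr[OF V(1) W(1) WU W(3) _ fc] by simp
      moreover have "W \<inter> U \<subseteq> V \<inter> U" using W by auto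
      ultimately have "\<forall>x\<in>\<phi> ` (W \<inter> U). b x \<noteq> b (\<phi> m)"
        using key[OF WU] by blast
      then show False using W V by blast
    qed
  next
    fix k assume k: "\<forall>W. opn W \<and> m \<in> W \<and> W \<subseteq> V \<longrightarrow> restr M V W (?f k) \<notin> Units (sect M W)"
    show "k = b (\<phi> m)"
    proof (rule ccontr)
      assume ne: "k \<noteq> b (\<phi> m)"
      \<comment> \<open>Continuity provides a neighborhood on which the body avoids
        \<open>k\<close>; there the shifted section is invertible, against the choice of
        \<open>k\<close>.\<close>
      have "continuous_map (subtopology (Euclidean_space p) (\<phi> ` (V \<inter> U))) euclideanreal b"
        using b smooth_on_continuous unfolding Cinf_def by blast
      then have "openin (subtopology (Euclidean_space p) (\<phi> ` (V \<inter> U)))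
          {x \<in> topspace (subtopology (Euclidean_space p) (\<phi> ` (V \<inter> U))). b x \<in> - {k}}"
        by (rule openin_continuous_map_preimage) auto
      moreover have "topspace (subtopology (Euclidean_space p) (\<phi> ` (V \<inter> U))) = \<phi> ` (V \<inter> U)"
        using open_image[OF VU] openin_subset by auto
      ultimately have "openin (subtopology (Euclidean_space p) (\<phi> ` (V \<inter> U))) {x \<in> \<phi> ` (V \<inter> U). b x \<in> - {k}}"
        by (simp only:)
      then have S: "openin (Euclidean_space p) {x \<in> \<phi> ` (V \<inter> U). b x \<in> - {k}}"
        using openin_open_subtopology[OF open_image[OF VU Int_lower2]] by blast
      define W where "W = V \<inter> {x \<in> U. \<phi> x \<in> {x \<in> \<phi> ` (V \<inter> U). b x \<in> - {k}}}"
      have W: "opn W" unfolding W_def using open_vimage[OF S] V(1) by blast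
      have mW: "m \<in> W" unfolding W_def using V ne by auto
      have "\<forall>x\<in>\<phi> ` W. b x \<noteq> k" unfolding W_def by auto
      moreover have "W \<subseteq> V \<inter> U" unfolding W_def by auto
      ultimately have "restr M V W (?f k) \<in> Units (sect M W)"
        using key[OF W] by blast
      then show False using k W mW unfolding W_def by blast
    qed
  qed
  then show ?thesis
    using V(2) by (simp add: base_projection_def b_def)
qed

end

section \<open>Constructions of graded spaces\<close>

lemma cring_real_ring: "cring real_ring"
  unfolding real_ring_def
  by (intro cringI abelian_groupI comm_monoidI)
    (auto simp: algebra_simps intro: exI[of _ "- x" for x])

lemma carrier_real_ring [simp]: "carrier real_ring = UNIV"
  by (simp add: real_ring_def)

lemma finite_Z2n: "finite (Z2n n)"
  using finite_lists_length_eq[of "UNIV :: bool set" n] by (simp add: Z2n_def)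

lemma deg_zero_in_Z2n: "deg_zero n \<in> Z2n n"
  by (simp add: Z2n_def deg_zero_def)

text \<open>Closure under negation comes from scalars, since the negative of \<open>a\<close> is its
  multiple by minus one.\<close>

lemma real_module_submoduleI:
  assumes A: "module real_ring A" and sub: "H \<subseteq> carrier A" and zero: "\<zero>\<^bsub>A\<^esub> \<in> H"
    and add: "\<And>a b. a \<in> H \<Longrightarrow> b \<in> H \<Longrightarrow> a \<oplus>\<^bsub>A\<^esub> b \<in> H" and smult: "\<And>r a. a \<in> H \<Longrightarrow> r \<odot>\<^bsub>A\<^esub> a \<in> H"
  shows "submodule H real_ring A"
proof -
  interpret A: module real_ring A by (rule A)
  have one: "\<one>\<^bsub>real_ring\<^esub> = 1" by (simp add: real_ring_def)
  have "\<ominus>\<^bsub>A\<^esub> a = (\<ominus>\<^bsub>real_ring\<^esub> \<one>\<^bsub>real_ring\<^esub>) \<odot>\<^bsub>A\<^esub> a" if "a \<in> H" for a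
    using A.smult_l_minus[of "\<one>\<^bsub>real_ring\<^esub>" a] that sub by auto
  then show ?thesis
    using assms by (intro A.submoduleI) auto
qed

text \<open>All other summands are trivial, so a sum over the degrees is just its term in degree
  zero, and this term is forced to be \<open>a\<close>.\<close>

lemma graded_space_degree_zero:
  assumes A: "module real_ring A"
    and homog: "\<And>i. i \<in> Z2n n \<Longrightarrow> homog A i = (if i = deg_zero n then carrier A else {\<zero>\<^bsub>A\<^esub>})"
  shows "graded_space n A"
proof -
  interpret A: module real_ring A by (rule A)
  have sum: "(\<Oplus>\<^bsub>A\<^esub>i\<in>Z2n n. c i) = c (deg_zero n)" if c: "c \<in> (\<Pi> i\<in>Z2n n. homog A i)" for c
  proof -
    have "(\<Oplus>\<^bsub>A\<^esub>i\<in>Z2n n. c i) = (\<Oplus>\<^bsub>A\<^esub>i\<in>Z2n n. if deg_zero n = i then c i else \<zero>\<^bsub>A\<^esub>)"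
      using c homog deg_zero_in_Z2n by (intro A.finsum_cong') (auto simp: Pi_iff split: if_splits)
    also have "\<dots> = c (deg_zero n)"
      using c homog deg_zero_in_Z2n by (intro A.finsum_singleton finite_Z2n) (auto simp: Pi_iff split: if_splits)
    finally show ?thesis .
  qed
  show ?thesis
  proof (intro graded_space.intro graded_space_axioms.intro A)
    show "submodule (homog A i) real_ring A" if "i \<in> Z2n n" for i
      using homog[OF that] A by (intro real_module_submoduleI) auto
    show "\<exists>!c. c \<in> (\<Pi>\<^sub>E i\<in>Z2n n. homog A i) \<and> a = (\<Oplus>\<^bsub>A\<^esub>i\<in>Z2n n. c i)" if a: "a \<in> carrier A" for a
    proof (rule ex1I)
      show "(\<lambda>i\<in>Z2n n. if i = deg_zero n then a else \<zero>\<^bsub>A\<^esub>) \<in> (\<Pi>\<^sub>E i\<in>Z2n n. homog A i) \<and>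
          a = (\<Oplus>\<^bsub>A\<^esub>i\<in>Z2n n. (\<lambda>i\<in>Z2n n. if i = deg_zero n then a else \<zero>\<^bsub>A\<^esub>) i)"
        using a homog deg_zero_in_Z2n by (subst sum) auto
    next
      fix c assume c: "c \<in> (\<Pi>\<^sub>E i\<in>Z2n n. homog A i) \<and> a = (\<Oplus>\<^bsub>A\<^esub>i\<in>Z2n n. c i)"
      then have "a = c (deg_zero n)"
        using sum[of c] by (auto simp: PiE_def)
      moreover have "c i = \<zero>\<^bsub>A\<^esub>" if "i \<in> Z2n n" "i \<noteq> deg_zero n" for i
        using c that homog by (auto simp: PiE_def Pi_iff)
      ultimately show "c = (\<lambda>i\<in>Z2n n. if i = deg_zero n then a else \<zero>\<^bsub>A\<^esub>)"
        using c by (intro PiE_ext[of c "Z2n n" "\<lambda>_. UNIV"]) (auto simp: PiE_def)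
    qed
  qed
qed

text \<open>A finite sum depends on the structure in which it is formed, carrier included; smaller
  and larger structure are compared by induction on the index set.\<close>

lemma finsum_same_operations:
  assumes A: "abelian_monoid A" and K: "abelian_monoid K"
    and ops: "carrier K \<subseteq> carrier A" "zero K = zero A" "add K = add A"
    and "finite I" "c \<in> I \<rightarrow> carrier K"
  shows "(\<Oplus>\<^bsub>K\<^esub>i\<in>I. c i) = (\<Oplus>\<^bsub>A\<^esub>i\<in>I. c i)"
proof -
  interpret A: abelian_monoid A by (rule A)
  interpret K: abelian_monoid K by (rule K)
  show ?thesis
    using assms(6,7)
  proof (induction I rule: finite_induct)
    case (insert i I)
    then have "c \<in> I \<rightarrow> carrier A" "c i \<in> carrier A"
      using ops(1) by auto
    then show ?case using insert ops(2,3) by simp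
  qed (simp add: ops)
qed

text \<open>The hypothesis on components says that the subspace is homogeneous. It puts the
  decomposition formed in \<open>A\<close> inside \<open>H\<close>; uniqueness is inherited from
  \<open>A\<close>.\<close>

lemma graded_subspace:
  assumes A: "graded_space n A"
    and H: "H \<subseteq> carrier A" "\<zero>\<^bsub>A\<^esub> \<in> H" "\<And>a b. a \<in> H \<Longrightarrow> b \<in> H \<Longrightarrow> a \<oplus>\<^bsub>A\<^esub> b \<in> H"
      "\<And>r a. a \<in> H \<Longrightarrow> r \<odot>\<^bsub>A\<^esub> a \<in> H"
    and components: "\<And>c i. c \<in> (\<Pi>\<^sub>E i\<in>Z2n n. homog A i) \<Longrightarrow> (\<Oplus>\<^bsub>A\<^esub>i\<in>Z2n n. c i) \<in> H \<Longrightarrow> i \<in> Z2n n \<Longrightarrow> c i \<in> H"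
  shows "graded_space n (A\<lparr>carrier := H, homog := \<lambda>i. homog A i \<inter> H\<rparr>)" (is "graded_space n ?K")
proof -
  interpret A: graded_space n A by (rule A)
  have HA: "a \<in> carrier A" if "a \<in> H" for a using H(1) that by blast
  have ops: "carrier ?K = H" "zero ?K = zero A" "add ?K = add A" "smult ?K = smult A"
    by simp_all
  interpret sH: submodule H real_ring A
    by (rule real_module_submoduleI) (use A.module_axioms H in auto)
  have sub: "submodule H real_ring A" ..
  have group: "abelian_group ?K"
  proof (rule abelian_groupI, unfold ops)
    fix x assume x: "x \<in> H"
    have "\<ominus>\<^bsub>A\<^esub> x \<in> H" using A.submoduleE(6)[OF sub x] .
    then show "\<exists>y\<in>H. y \<oplus>\<^bsub>A\<^esub> x = \<zero>\<^bsub>A\<^esub>"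
      using A.l_neg HA[OF x] by blast
  qed (use H HA in \<open>auto simp: A.a_ac\<close>)
  have "module real_ring ?K"
    by (rule moduleI[OF cring_real_ring group], unfold ops)
      (use H HA in \<open>auto simp: A.smult_l_distr A.smult_r_distr A.smult_assoc1\<close>)
  then interpret K: module real_ring ?K .
  have sum: "(\<Oplus>\<^bsub>?K\<^esub>i\<in>Z2n n. c i) = (\<Oplus>\<^bsub>A\<^esub>i\<in>Z2n n. c i)" if "c \<in> Z2n n \<rightarrow> H" for c
    by (rule finsum_same_operations) (use that H(1) A.abelian_monoid_axioms K.abelian_monoid_axioms finite_Z2n in auto)
  show ?thesis
  proof (intro graded_space.intro graded_space_axioms.intro K.module_axioms)
    fix i assume i: "i \<in> Z2n n"
    note sm = A.homog_submodule[OF i]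
    have zero: "\<zero>\<^bsub>A\<^esub> \<in> homog A i"
      using subgroup.one_closed[OF submodule.axioms(1)[OF sm]] by simp
    show "submodule (homog ?K i) real_ring ?K"
      by (rule real_module_submoduleI[OF K.module_axioms])
        (use H zero A.submoduleE(4,5)[OF sm] in auto)
  next
    fix a assume "a \<in> carrier ?K"
    then have a: "a \<in> H" by simp
    obtain c where c: "c \<in> (\<Pi>\<^sub>E i\<in>Z2n n. homog A i)" "a = (\<Oplus>\<^bsub>A\<^esub>i\<in>Z2n n. c i)"
      using A.direct_sum[OF HA[OF a]] by blast
    have cH: "c i \<in> H" if "i \<in> Z2n n" for i
      using components[OF c(1) _ that] a c(2) by simp
    show "\<exists>!c. c \<in> (\<Pi>\<^sub>E i\<in>Z2n n. homog ?K i) \<and> a = (\<Oplus>\<^bsub>?K\<^esub>i\<in>Z2n n. c i)"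
    proof (rule ex1I)
      show "c \<in> (\<Pi>\<^sub>E i\<in>Z2n n. homog ?K i) \<and> a = (\<Oplus>\<^bsub>?K\<^esub>i\<in>Z2n n. c i)"
        using c cH sum[of c] by (auto simp: PiE_iff)
    next
      fix d assume d: "d \<in> (\<Pi>\<^sub>E i\<in>Z2n n. homog ?K i) \<and> a = (\<Oplus>\<^bsub>?K\<^esub>i\<in>Z2n n. d i)"
      then have "d \<in> (\<Pi>\<^sub>E i\<in>Z2n n. homog A i)" "a = (\<Oplus>\<^bsub>A\<^esub>i\<in>Z2n n. d i)"
        using sum[of d] by (auto simp: PiE_iff)
      then show "d = c"
        using c A.direct_sum[OF HA[OF a]] by blast
    qed
  qed
qed

section \<open>The sheaf of smooth functions on a manifold\<close>

lemma smooth_function_sheaf_simps [simp]: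
  "base (smooth_function_sheaf n p X \<C>) = X"
  "carrier (sect (smooth_function_sheaf n p X \<C>) U) = smooth_functions p \<C> U"
  "mult (sect (smooth_function_sheaf n p X \<C>) U) = (\<lambda>f g. \<lambda>m\<in>U. f m * g m)"
  "one (sect (smooth_function_sheaf n p X \<C>) U) = (\<lambda>m\<in>U. 1)"
  "zero (sect (smooth_function_sheaf n p X \<C>) U) = (\<lambda>m\<in>U. 0)"
  "add (sect (smooth_function_sheaf n p X \<C>) U) = (\<lambda>f g. \<lambda>m\<in>U. f m + g m)"
  "smult (sect (smooth_function_sheaf n p X \<C>) U) = (\<lambda>r f. \<lambda>m\<in>U. r * f m)"
  "homog (sect (smooth_function_sheaf n p X \<C>) U) i =
    (if i = deg_zero n then smooth_functions p \<C> U else {\<lambda>m\<in>U. 0})"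
  "restr (smooth_function_sheaf n p X \<C>) U V f = restrict f V"
  by (simp_all add: smooth_function_sheaf_def)

locale smooth_mfd =
  fixes p :: nat and X :: "'m topology" and \<C> :: "('m set \<times> ('m \<Rightarrow> nat \<Rightarrow> real)) set"
  assumes smooth_manifold: "smooth_manifold p X \<C>"
begin

lemma
  assumes "(V, \<phi>) \<in> \<C>"
  shows chart_open: "openin X V" and chart_range_open: "openin (Euclidean_space p) (\<phi> ` V)"
    and chart_homeo: "homeomorphic_map (subtopology X V) (subtopology (Euclidean_space p) (\<phi> ` V)) \<phi>"
proof -
  have "\<forall>(U, \<phi>)\<in>\<C>. openin X U \<and> openin (Euclidean_space p) (\<phi> ` U) \<and>
      homeomorphic_map (subtopology X U) (subtopology (Euclidean_space p) (\<phi> ` U)) \<phi>"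
    using smooth_manifold by (simp add: smooth_manifold_def)
  from bspec[OF this assms] show "openin X V" "openin (Euclidean_space p) (\<phi> ` V)"
    "homeomorphic_map (subtopology X V) (subtopology (Euclidean_space p) (\<phi> ` V)) \<phi>"
    by simp_all
qed

lemma chart_inj:
  assumes "(V, \<phi>) \<in> \<C>"
  shows "inj_on \<phi> V"
proof -
  have "topspace (subtopology X V) = V"
    using openin_subset[OF chart_open[OF assms]] by auto
  then show ?thesis
    using homeomorphic_imp_injective_map[OF chart_homeo[OF assms]] by metis
qed

lemma chart_image_open:
  assumes V: "(V, \<phi>) \<in> \<C>" and U: "openin X U"
  shows "openin (Euclidean_space p) (\<phi> ` (U \<inter> V))"
proof -
  have "openin (subtopology X V) (U \<inter> V)"
    using U openin_subtopology_Int by blast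
  then have "openin (subtopology (Euclidean_space p) (\<phi> ` V)) (\<phi> ` (U \<inter> V))"
    using homeomorphic_imp_open_map[OF chart_homeo[OF V]] unfolding open_map_def by blast
  then show ?thesis using chart_range_open[OF V] openin_trans_full by blast
qed

lemma smooth_functions_extensional: "f \<in> smooth_functions p \<C> U \<Longrightarrow> f \<in> extensional U"
  by (simp add: smooth_functions_def)

lemma smooth_functions_chart:
  "f \<in> smooth_functions p \<C> U \<Longrightarrow> (V, \<phi>) \<in> \<C> \<Longrightarrow> smooth_on p (\<phi> ` (U \<inter> V)) (\<lambda>x. f (inv_into V \<phi> x))"
  by (auto simp: smooth_functions_def)

text \<open>Reduces each closure property to a formula in coordinates. Injectivity of the chart
  makes \<open>inv_into\<close> return to \<open>U\<close> from the image of
  \<open>U \<inter> V\<close>, where the restriction changes nothing.\<close>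

lemma restrict_smooth_functions:
  assumes U: "openin X U"
    and f: "\<And>V \<phi>. (V, \<phi>) \<in> \<C> \<Longrightarrow> smooth_on p (\<phi> ` (U \<inter> V)) (\<lambda>x. f (inv_into V \<phi> x))"
  shows "restrict f U \<in> smooth_functions p \<C> U"
proof -
  have "smooth_on p (\<phi> ` (U \<inter> V)) (\<lambda>x. restrict f U (inv_into V \<phi> x))" if V: "(V, \<phi>) \<in> \<C>" for V \<phi>
  proof (subst smooth_on_cong[OF chart_image_open[OF V U], of _ "\<lambda>x. f (inv_into V \<phi> x)"])
    show "restrict f U (inv_into V \<phi> x) = f (inv_into V \<phi> x)" if "x \<in> \<phi> ` (U \<inter> V)" for x
      using that chart_inj[OF V] by auto
  qed (rule f[OF V])
  then show ?thesis by (auto simp: smooth_functions_def)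
qed

lemma smooth_functions_const: "openin X U \<Longrightarrow> (\<lambda>m\<in>U. c) \<in> smooth_functions p \<C> U"
  by (rule restrict_smooth_functions) (auto intro: smooth_on_const)

lemma smooth_functions_add:
  "openin X U \<Longrightarrow> f \<in> smooth_functions p \<C> U \<Longrightarrow> g \<in> smooth_functions p \<C> U
    \<Longrightarrow> (\<lambda>m\<in>U. f m + g m) \<in> smooth_functions p \<C> U"
  by (rule restrict_smooth_functions) (auto intro: smooth_on_add smooth_functions_chart)

lemma smooth_functions_mult:
  "openin X U \<Longrightarrow> f \<in> smooth_functions p \<C> U \<Longrightarrow> g \<in> smooth_functions p \<C> U
    \<Longrightarrow> (\<lambda>m\<in>U. f m * g m) \<in> smooth_functions p \<C> U"
  by (rule restrict_smooth_functions) (auto intro: smooth_on_mult smooth_functions_chart)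

lemma smooth_functions_smult:
  "openin X U \<Longrightarrow> f \<in> smooth_functions p \<C> U \<Longrightarrow> (\<lambda>m\<in>U. r * f m) \<in> smooth_functions p \<C> U"
  by (rule restrict_smooth_functions) (auto intro: smooth_on_mult smooth_on_const smooth_functions_chart)

lemma smooth_functions_restrict:
  assumes "openin X V" "V \<subseteq> U" "f \<in> smooth_functions p \<C> U"
  shows "restrict f V \<in> smooth_functions p \<C> V"
proof (rule restrict_smooth_functions[OF assms(1)])
  fix W \<phi> assume W: "(W, \<phi>) \<in> \<C>"
  show "smooth_on p (\<phi> ` (V \<inter> W)) (\<lambda>x. f (inv_into W \<phi> x))"
    by (rule smooth_on_subset[OF _ smooth_functions_chart[OF assms(3) W]]) (use assms(2) in auto)
qed

lemma smooth_functions_glue: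
  assumes \<U>: "\<And>U. U \<in> \<U> \<Longrightarrow> openin X U" "\<And>U. U \<in> \<U> \<Longrightarrow> s U \<in> smooth_functions p \<C> U"
    and compat: "\<And>U V. U \<in> \<U> \<Longrightarrow> V \<in> \<U> \<Longrightarrow> restrict (s U) (U \<inter> V) = restrict (s V) (U \<inter> V)"
  shows "\<exists>!f. f \<in> smooth_functions p \<C> (\<Union>\<U>) \<and> (\<forall>U\<in>\<U>. restrict f U = s U)"
proof (rule ex1I)
  \<comment> \<open>Any member containing \<open>m\<close> may provide the value, since compatible
    sections agree on overlaps.\<close>
  define f where "f = (\<lambda>m\<in>\<Union>\<U>. s (SOME U. U \<in> \<U> \<and> m \<in> U) m)"
  have f: "f m = s U m" if "U \<in> \<U>" "m \<in> U" for U m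
  proof -
    let ?V = "SOME V. V \<in> \<U> \<and> m \<in> V"
    have V: "?V \<in> \<U> \<and> m \<in> ?V"
      by (rule someI[of _ U]) (use that in simp)
    then have "restrict (s ?V) (?V \<inter> U) m = restrict (s U) (?V \<inter> U) m"
      using compat[of ?V U] that by simp
    then show ?thesis using V that by (auto simp: f_def)
  qed
  have "smooth_on p (\<phi> ` (\<Union>\<U> \<inter> V)) (\<lambda>x. f (inv_into V \<phi> x))" if V: "(V, \<phi>) \<in> \<C>" for V \<phi>
  proof -
    have "smooth_on p (\<phi> ` (U \<inter> V)) (\<lambda>x. f (inv_into V \<phi> x))" if U: "U \<in> \<U>" for U
    proof (subst smooth_on_cong[OF chart_image_open[OF V \<U>(1)[OF U]], of _ "\<lambda>x. s U (inv_into V \<phi> x)"])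
      show "f (inv_into V \<phi> x) = s U (inv_into V \<phi> x)" if "x \<in> \<phi> ` (U \<inter> V)" for x
        using that chart_inj[OF V] f[OF U] by auto
    qed (rule smooth_functions_chart[OF \<U>(2)[OF U] V])
    \<comment> \<open>Smoothness in a chart is pasted over the images of the cover, which are
      open.\<close>
    then have "smooth_on p (\<Union>((\<lambda>U. \<phi> ` (U \<inter> V)) ` \<U>)) (\<lambda>x. f (inv_into V \<phi> x))"
      using chart_image_open[OF V \<U>(1)] by (intro smooth_on_Union) auto
    moreover have "\<phi> ` (\<Union>\<U> \<inter> V) = \<Union>((\<lambda>U. \<phi> ` (U \<inter> V)) ` \<U>)" by auto
    ultimately show ?thesis by simp
  qed
  then have "f \<in> smooth_functions p \<C> (\<Union>\<U>)"
    by (auto simp: smooth_functions_def f_def)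
  moreover have "restrict f U = s U" if "U \<in> \<U>" for U
    using f[OF that] smooth_functions_extensional[OF \<U>(2)[OF that]] by (auto simp: extensional_def fun_eq_iff)
  ultimately show f': "f \<in> smooth_functions p \<C> (\<Union>\<U>) \<and> (\<forall>U\<in>\<U>. restrict f U = s U)" by blast
  fix g assume g: "g \<in> smooth_functions p \<C> (\<Union>\<U>) \<and> (\<forall>U\<in>\<U>. restrict g U = s U)"
  show "g = f"
  proof (rule extensionalityI)
    show "g \<in> extensional (\<Union>\<U>)" "f \<in> extensional (\<Union>\<U>)"
      using g f' smooth_functions_extensional by blast+
    fix m assume "m \<in> \<Union>\<U>"
    then obtain U where U: "U \<in> \<U>" "m \<in> U" by blast
    then have "restrict g U m = restrict f U m" using g f' by simp
    then show "g m = f m" using U by simp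
  qed
qed

lemma graded_algebra_smooth_functions:
  assumes U: "openin X U"
  shows "graded_comm_algebra n (sect (smooth_function_sheaf n p X \<C>) U)" (is "graded_comm_algebra n ?A")
proof -
  note closed = smooth_functions_const[OF U] smooth_functions_add[OF U] smooth_functions_mult[OF U]
    smooth_functions_smult[OF U]
  have ext: "(\<lambda>m\<in>U. f m) = f" if "f \<in> smooth_functions p \<C> U" for f
    using smooth_functions_extensional[OF that] by (auto simp: extensional_def fun_eq_iff)
  have group: "abelian_group ?A"
  proof (rule abelian_groupI)
    fix x assume x: "x \<in> carrier ?A"
    show "\<exists>y\<in>carrier ?A. y \<oplus>\<^bsub>?A\<^esub> x = \<zero>\<^bsub>?A\<^esub>"
      using x closed(4)[of x "- 1"] by (intro bexI[of _ "\<lambda>m\<in>U. - 1 * x m"]) (auto cong: restrict_cong)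
  qed (use closed ext in \<open>auto simp: algebra_simps cong: restrict_cong\<close>)
  have monoid: "monoid ?A"
    by (rule monoidI) (use closed ext in \<open>auto simp: algebra_simps cong: restrict_cong\<close>)
  have "ring ?A"
    by (rule ringI[OF group monoid]) (auto simp: algebra_simps cong: restrict_cong)
  then interpret ring ?A .
  have module: "module real_ring ?A"
    by (rule moduleI[OF cring_real_ring group])
      (use closed ext in \<open>auto simp: algebra_simps real_ring_def cong: restrict_cong\<close>)
  then interpret graded_space n ?A
    by (rule graded_space_degree_zero) simp
  \<comment> \<open>The graded laws have content in degree zero only, where the sign is 1; a section
    of any other degree is the zero function.\<close>
  have pair: "deg_add (deg_zero n) (deg_zero n) = deg_zero n" "deg_pairing n (deg_zero n) (deg_zero n) = 0"
    by (auto simp: deg_add_def deg_pairing_def deg_zero_def zip_replicate)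
  show ?thesis
  proof unfold_locales
    fix r x y assume "x \<in> carrier ?A" "y \<in> carrier ?A"
    show "(r \<odot>\<^bsub>?A\<^esub> x) \<otimes>\<^bsub>?A\<^esub> y = r \<odot>\<^bsub>?A\<^esub> (x \<otimes>\<^bsub>?A\<^esub> y)" "x \<otimes>\<^bsub>?A\<^esub> (r \<odot>\<^bsub>?A\<^esub> y) = r \<odot>\<^bsub>?A\<^esub> (x \<otimes>\<^bsub>?A\<^esub> y)"
      by (auto simp: algebra_simps cong: restrict_cong)
  next
    fix i j x y assume "i \<in> Z2n n" "j \<in> Z2n n" and x: "x \<in> homog ?A i" and y: "y \<in> homog ?A j"
    show "x \<otimes>\<^bsub>?A\<^esub> y \<in> homog ?A (deg_add i j)"
    proof (cases "i = deg_zero n \<and> j = deg_zero n")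
      case True
      then show ?thesis using x y pair closed by simp
    next
      case False
      then have "x = (\<lambda>m\<in>U. 0) \<or> y = (\<lambda>m\<in>U. 0)" using x y by (auto split: if_splits)
      then have "x \<otimes>\<^bsub>?A\<^esub> y = (\<lambda>m\<in>U. 0)" by (auto cong: restrict_cong)
      then show ?thesis using closed(1) by simp
    qed
    show "x \<otimes>\<^bsub>?A\<^esub> y = ((-1) ^ deg_pairing n i j) \<odot>\<^bsub>?A\<^esub> (y \<otimes>\<^bsub>?A\<^esub> x)"
    proof (cases "i = deg_zero n \<and> j = deg_zero n")
      case True
      then show ?thesis using pair by (auto simp: algebra_simps cong: restrict_cong)
    next
      case False
      then have "x = (\<lambda>m\<in>U. 0) \<or> y = (\<lambda>m\<in>U. 0)" using x y by (auto split: if_splits)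
      then show ?thesis by (auto cong: restrict_cong)
    qed
  qed
qed

lemma graded_algebra_hom_restrict:
  assumes "openin X V" "V \<subseteq> U"
  shows "graded_algebra_hom n (sect (smooth_function_sheaf n p X \<C>) U) (sect (smooth_function_sheaf n p X \<C>) V)
    (\<lambda>f. restrict f V)"
  using assms smooth_functions_restrict[OF assms]
  unfolding graded_algebra_hom_def graded_linear_def
  by (auto simp: restrict_def fun_eq_iff subset_iff)

lemma smooth_function_sheaf: "graded_comm_algebra_sheaf n (smooth_function_sheaf n p X \<C>)" (is "graded_comm_algebra_sheaf n ?S")
proof -
  have restr: "restr ?S U V = (\<lambda>f. restrict f V)" for U V
    by (simp add: fun_eq_iff)
  note space = graded_comm_algebra.axioms(1)[OF graded_algebra_smooth_functions]
  note lin = graded_algebra_homD(1)[OF graded_algebra_hom_restrict]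
  have refl: "restrict f U = f" if "f \<in> smooth_functions p \<C> U" for f U
    using smooth_functions_extensional[OF that] extensional_restrict by blast
  have "graded_sheaf n ?S"
    unfolding graded_sheaf_def smooth_function_sheaf_simps(1,2) restr
  proof (intro conjI allI impI ballI)
    show "\<exists>!f. f \<in> smooth_functions p \<C> (\<Union>\<U>) \<and> (\<forall>U\<in>\<U>. restrict f U = s U)"
      if "(\<forall>U\<in>\<U>. openin X U \<and> s U \<in> smooth_functions p \<C> U) \<and>
        (\<forall>U\<in>\<U>. \<forall>V\<in>\<U>. restrict (s U) (U \<inter> V) = restrict (s V) (U \<inter> V))" for \<U> s
      using that by (intro smooth_functions_glue) blast+
  qed (use space lin refl in \<open>auto simp: Int_absorb2 restrict_restrict inf_absorb2\<close>)
  then show ?thesis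
    unfolding graded_comm_algebra_sheaf_def smooth_function_sheaf_simps(1) restr
    using graded_algebra_smooth_functions graded_algebra_hom_restrict by blast
qed

end

section \<open>The base projection of a supermanifold\<close>

text \<open>Collects all superdomain charts and forgets their section maps, so no covering family
  has to be chosen.\<close>

definition base_atlas :: "nat \<Rightarrow> nat \<Rightarrow> ('m, 'a) ringed_space \<Rightarrow> ('m set \<times> ('m \<Rightarrow> nat \<Rightarrow> real)) set" where
  "base_atlas n p M = {(U, \<phi>). \<exists>ds D \<psi> \<phi>' \<psi>'. superchart n M p U ds D \<phi> \<psi> \<phi>' \<psi>'}"

lemma base_atlasE:
  assumes "(U, \<phi>) \<in> base_atlas n p M"
  obtains ds D \<psi> \<phi>' \<psi>' where "superchart n M p U ds D \<phi> \<psi> \<phi>' \<psi>'"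
proof -
  have "\<exists>ds D \<psi> \<phi>' \<psi>'. superchart n M p U ds D \<phi> \<psi> \<phi>' \<psi>'"
    using assms by (simp add: base_atlas_def)
  then show thesis
    using that by (elim exE)
qed

lemma superchart_base_atlas: "superchart n M p U ds D \<phi> \<psi> \<phi>' \<psi>' \<Longrightarrow> (U, \<phi>) \<in> base_atlas n p M"
  unfolding base_atlas_def by blast

lemma supermanifold_superchart:
  assumes M: "supermanifold n p qs M" and m: "m \<in> topspace (base M)"
  shows "\<exists>U ds D \<phi> \<psi> \<phi>' \<psi>'. superchart n M p U ds D \<phi> \<psi> \<phi>' \<psi>' \<and> m \<in> U"
proof -
  have "graded_comm_algebra_sheaf n M"
    using M by (simp add: supermanifold_def locally_ringed_space_def)
  then interpret sheaf_of_graded_algebras n M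
    by (rule sheaf_of_graded_algebrasI)
  obtain U ds D where U: "opn U" "m \<in> U" "openin (Euclidean_space p) D"
    and iso: "lrs_isomorphic n (open_subspace M U) (superdomain n p ds D)"
    using M m unfolding supermanifold_def by meson
  have "\<exists>\<phi> \<psi> \<phi>' \<psi>'. superchart_axioms n M p U ds D \<phi> \<psi> \<phi>' \<psi>'"
    using iso U(1,3) unfolding lrs_isomorphic_def superchart_axioms_def by simp
  then show ?thesis
    using U sheaf_of_graded_algebras_axioms superchart.intro by blast
qed

locale base_supermanifold = sheaf_of_graded_algebras n M
  for n :: nat and M :: "('m, 'a) ringed_space" +
  fixes p :: nat
  assumes hausdorff: "Hausdorff_space (base M)" and second_countable: "second_countable (base M)"
    and superchart_at: "m \<in> topspace (base M) \<Longrightarrow>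
      \<exists>U ds D \<phi> \<psi> \<phi>' \<psi>'. superchart n M p U ds D \<phi> \<psi> \<phi>' \<psi>' \<and> m \<in> U"
begin

abbreviation "\<epsilon> \<equiv> base_projection M"
abbreviation "\<C> \<equiv> base_atlas n p M"

lemma superchart_in:
  assumes "opn V" "m \<in> V"
  obtains U ds D \<phi> \<psi> \<phi>' \<psi>' where "superchart n M p U ds D \<phi> \<psi> \<phi>' \<psi>'" "m \<in> U"
  using superchart_at[of m] assms openin_subset by blast

section \<open>Local properties of the base projection\<close>

lemma base_projection_extensional: "\<epsilon> V f \<in> extensional V"
  by (simp add: base_projection_def)

text \<open>In a chart around \<open>m\<close>, both sides are the value at \<open>\<phi> m\<close>
  of bodies that differ by a restriction.\<close>

lemma base_projection_restr:
  assumes V: "opn V" and W: "opn W" "W \<subseteq> V" and f: "f \<in> carrier (sect M V)"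
  shows "\<epsilon> W (restr M V W f) = restrict (\<epsilon> V f) W"
proof (rule extensionalityI[OF base_projection_extensional restrict_extensional])
  fix m assume m: "m \<in> W"
  obtain U ds D \<phi> \<psi> \<phi>' \<psi>' where c: "superchart n M p U ds D \<phi> \<psi> \<phi>' \<psi>'" "m \<in> U"
    using superchart_in[OF W(1) m] .
  interpret superchart n M p U ds D \<phi> \<psi> \<phi>' \<psi>' by (rule c)
  have WU: "opn (W \<inter> U)" and VU: "opn (V \<inter> U)"
    using V W open_dom by blast+
  have WV: "W \<inter> U \<subseteq> V \<inter> U" using W by blast
  have "\<epsilon> W (restr M V W f) m = body (W \<inter> U) (restr M W (W \<inter> U) (restr M V W f)) (\<phi> m)"
    using base_projection_chart[OF W(1) m c(2) restr_closed[OF V W f]] .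
  also have "restr M W (W \<inter> U) (restr M V W f) = restr M (V \<inter> U) (W \<inter> U) (restr M V (V \<inter> U) f)"
    using restr_restr[OF V W(1) WU W(2) _ f] restr_restr[OF V VU WU _ WV f] by simp
  also have "body (W \<inter> U) \<dots> (\<phi> m) = body (V \<inter> U) (restr M V (V \<inter> U) f) (\<phi> m)"
    using body_restr[OF VU _ WU WV restr_closed[OF V VU _ f]] m c(2) by simp
  also have "\<dots> = \<epsilon> V f m"
    using base_projection_chart[OF V _ c(2) f] m W(2) by auto
  finally show "\<epsilon> W (restr M V W f) m = restrict (\<epsilon> V f) W m"
    using m by simp
qed

text \<open>At a fixed point, \<epsilon> is restriction to a chart followed by the section map and
  evaluation of the constant coefficient, and each of these respects the operations.\<close>

lemma base_projection_hom:
  assumes V: "opn V" and m: "m \<in> V" and f: "f \<in> carrier (sect M V)" and g: "g \<in> carrier (sect M V)"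
  shows "\<epsilon> V (f \<otimes>\<^bsub>sect M V\<^esub> g) m = \<epsilon> V f m * \<epsilon> V g m"
    and "\<epsilon> V (f \<oplus>\<^bsub>sect M V\<^esub> g) m = \<epsilon> V f m + \<epsilon> V g m"
    and "\<epsilon> V (r \<odot>\<^bsub>sect M V\<^esub> f) m = r * \<epsilon> V f m"
    and "\<epsilon> V \<one>\<^bsub>sect M V\<^esub> m = 1"
proof -
  obtain U ds D \<phi> \<psi> \<phi>' \<psi>' where c: "superchart n M p U ds D \<phi> \<psi> \<phi>' \<psi>'" "m \<in> U"
    using superchart_in[OF V m] .
  interpret superchart n M p U ds D \<phi> \<psi> \<phi>' \<psi>' by (rule c)
  interpret A: graded_comm_algebra n "sect M V" by (rule sect_algebra[OF V])
  have VU: "opn (V \<inter> U)" using V open_dom by blast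
  have sub: "V \<inter> U \<subseteq> U" "V \<inter> U \<subseteq> V" by auto
  have x: "\<phi> m \<in> \<phi> ` (V \<inter> U)" using m c(2) by blast
  have sm: "r \<odot>\<^bsub>sect M V\<^esub> f \<in> carrier (sect M V)"
    using f by (intro A.smult_closed) simp_all
  note e = base_projection_chart[OF V m c(2)]
  note h = restr_hom[OF V VU sub(2)]
  note r = restr_closed[OF V VU sub(2)]
  note b = body_hom[OF VU sub(1) x r[OF f] r[OF g]]
  show "\<epsilon> V (f \<otimes>\<^bsub>sect M V\<^esub> g) m = \<epsilon> V f m * \<epsilon> V g m"
    using e[OF f] e[OF g] e[OF A.m_closed[OF f g]] graded_algebra_homD(2)[OF h f g] b(1) by simp
  show "\<epsilon> V (f \<oplus>\<^bsub>sect M V\<^esub> g) m = \<epsilon> V f m + \<epsilon> V g m"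
    using e[OF f] e[OF g] e[OF A.a_closed[OF f g]] graded_linearD(2)[OF graded_algebra_homD(1)[OF h] f g] b(2) by simp
  show "\<epsilon> V (r \<odot>\<^bsub>sect M V\<^esub> f) m = r * \<epsilon> V f m"
    using e[OF f] e[OF sm] graded_linearD(3)[OF graded_algebra_homD(1)[OF h] f] b(3) by simp
  show "\<epsilon> V \<one>\<^bsub>sect M V\<^esub> m = 1"
    using e[OF A.one_closed] graded_algebra_homD(3)[OF h] b(4) by simp
qed

text \<open>Smooth functions live in degree zero, so this is what makes \<epsilon> respect the
  grading. It also puts every section of nonzero degree into the kernel.\<close>

lemma base_projection_homog:
  assumes V: "opn V" and i: "i \<in> Z2n n" "i \<noteq> deg_zero n" and f: "f \<in> homog (sect M V) i"
  shows "\<epsilon> V f = (\<lambda>m\<in>V. 0)"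
proof (rule extensionalityI[OF base_projection_extensional restrict_extensional])
  fix m assume m: "m \<in> V"
  obtain U ds D \<phi> \<psi> \<phi>' \<psi>' where c: "superchart n M p U ds D \<phi> \<psi> \<phi>' \<psi>'" "m \<in> U"
    using superchart_in[OF V m] .
  interpret superchart n M p U ds D \<phi> \<psi> \<phi>' \<psi>' by (rule c)
  interpret A: graded_comm_algebra n "sect M V" by (rule sect_algebra[OF V])
  have VU: "opn (V \<inter> U)" using V open_dom by blast
  have fc: "f \<in> carrier (sect M V)"
    using A.submoduleE(1)[OF A.homog_submodule[OF i(1)]] f by blast
  have "restr M V (V \<inter> U) f \<in> homog (sect M (V \<inter> U)) i"
    using graded_linearD(4)[OF restr_linear[OF V VU] i(1) f] by simp
  then have "body (V \<inter> U) (restr M V (V \<inter> U) f) (\<phi> m) = 0"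
    using m c(2) by (intro body_homog[OF VU _ i]) auto
  then show "\<epsilon> V f m = (\<lambda>m\<in>V. 0) m"
    using base_projection_chart[OF V m c(2) fc] m by simp
qed

text \<open>\<open>V\<close> and the chart need not be related, and \<open>f\<close> may have been
  built in another chart; this is what lets charts be compared.\<close>

lemma base_projection_coordinates:
  assumes c: "superchart n M p U ds D \<phi> \<psi> \<phi>' \<psi>'" and V: "opn V" and f: "f \<in> carrier (sect M V)"
  shows "smooth_on p (\<phi> ` (V \<inter> U)) (\<lambda>x. \<epsilon> V f (inv_into U \<phi> x))"
proof -
  interpret superchart n M p U ds D \<phi> \<psi> \<phi>' \<psi>' by (rule c)
  have VU: "opn (V \<inter> U)" using V open_dom by blast
  have eq: "\<epsilon> V f (inv_into U \<phi> x) = body (V \<inter> U) (restr M V (V \<inter> U) f) x" if "x \<in> \<phi> ` (V \<inter> U)" for x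
    using that base_projection_chart[OF V _ _ f] chart_inj by auto
  have "smooth_on p (\<phi> ` (V \<inter> U)) (body (V \<inter> U) (restr M V (V \<inter> U) f))"
    using body_Cinf[OF VU _ restr_closed[OF V VU _ f]] by (simp add: Cinf_def)
  then show ?thesis
    using smooth_on_cong[OF open_image[OF VU] eq] by simp
qed

text \<open>Serves twice: for the coordinate functions of a chart, which compare charts, and for
  arbitrary smooth functions, which give surjectivity on stalks.\<close>

lemma base_projection_lift:
  assumes c: "superchart n M p U ds D \<phi> \<psi> \<phi>' \<psi>'" and V: "opn V" "V \<subseteq> U"
    and h: "smooth_on p (\<phi> ` V) h"
  shows "\<exists>f\<in>carrier (sect M V). \<forall>m\<in>V. \<epsilon> V f m = h (\<phi> m)"
proof -
  interpret superchart n M p U ds D \<phi> \<psi> \<phi>' \<psi>' by (rule c)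
  obtain f where f: "f \<in> carrier (sect M V)" "body V f = restrict h (\<phi> ` V)"
    using body_lift[OF V restrict_Cinf[OF open_image[OF V] h]] by blast
  have "\<epsilon> V f m = h (\<phi> m)" if m: "m \<in> V" for m
  proof -
    have "V \<inter> U = V" using V(2) by blast
    then show ?thesis
      using base_projection_chart[OF V(1) m _ f(1)] restr_self[OF V(1) f(1)] m V(2) f(2) by auto
  qed
  then show ?thesis using f(1) by blast
qed

lemma smooth_manifold_base_atlas: "smooth_manifold p (base M) \<C>"
proof -
  have 1: "openin (base M) U \<and> openin (Euclidean_space p) (\<phi> ` U) \<and>
      homeomorphic_map (subtopology (base M) U) (subtopology (Euclidean_space p) (\<phi> ` U)) \<phi>"
    if c: "(U, \<phi>) \<in> \<C>" for U \<phi>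
  proof -
    obtain ds D \<psi> \<phi>' \<psi>' where "superchart n M p U ds D \<phi> \<psi> \<phi>' \<psi>'"
      using c by (rule base_atlasE)
    then interpret superchart n M p U ds D \<phi> \<psi> \<phi>' \<psi>' .
    show ?thesis using open_dom open_D chart_image chart_homeomorphic by simp
  qed
  have 2: "topspace (base M) = (\<Union>(U, \<phi>)\<in>\<C>. U)"
  proof
    show "topspace (base M) \<subseteq> (\<Union>(U, \<phi>)\<in>\<C>. U)"
    proof
      fix m assume "m \<in> topspace (base M)"
      then obtain U ds D \<phi> \<psi> \<phi>' \<psi>' where "superchart n M p U ds D \<phi> \<psi> \<phi>' \<psi>'" "m \<in> U"
        using superchart_at by blast
      then have "(U, \<phi>) \<in> \<C>" "m \<in> U" using superchart_base_atlas by blast+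
      then show "m \<in> (\<Union>(U, \<phi>)\<in>\<C>. U)" by blast
    qed
    show "(\<Union>(U, \<phi>)\<in>\<C>. U) \<subseteq> topspace (base M)"
      using 1 openin_subset by fastforce
  qed
  have 3: "smooth_on p (\<phi> ` (U \<inter> V)) (\<lambda>x. \<theta> (inv_into U \<phi> x) i)"
    if U: "(U, \<phi>) \<in> \<C>" and V: "(V, \<theta>) \<in> \<C>" for U \<phi> V \<theta> i
  proof -
    obtain ds D \<psi> \<phi>' \<psi>' where cU: "superchart n M p U ds D \<phi> \<psi> \<phi>' \<psi>'"
      using U by (rule base_atlasE)
    obtain ds2 D2 \<psi>2 \<phi>2' \<psi>2' where cV: "superchart n M p V ds2 D2 \<theta> \<psi>2 \<phi>2' \<psi>2'"
      using V by (rule base_atlasE)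
    interpret U: superchart n M p U ds D \<phi> \<psi> \<phi>' \<psi>' by (rule cU)
    interpret V: superchart n M p V ds2 D2 \<theta> \<psi>2 \<phi>2' \<psi>2' by (rule cV)
    \<comment> \<open>The section is built with the chart \<theta> and read below in the chart
      \<phi>.\<close>
    obtain f where f: "f \<in> carrier (sect M V)" "\<And>m. m \<in> V \<Longrightarrow> \<epsilon> V f m = \<theta> m i"
      using base_projection_lift[OF cV V.open_dom order_refl smooth_on_coordinate[of p _ i]] by blast
    have op: "openin (Euclidean_space p) (\<phi> ` (V \<inter> U))"
      using U.open_image U.open_dom V.open_dom by auto
    have eq: "\<epsilon> V f (inv_into U \<phi> x) = \<theta> (inv_into U \<phi> x) i" if "x \<in> \<phi> ` (V \<inter> U)" for x
      using that f(2) U.chart_inj by auto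
    show ?thesis
      using iffD1[OF smooth_on_cong[OF op eq] base_projection_coordinates[OF cU V.open_dom f(1)]]
      by (simp only: Int_commute)
  qed
  show ?thesis
    unfolding smooth_manifold_def
  proof (intro conjI hausdorff second_countable 2 ballI)
    show "case z of (U, \<phi>) \<Rightarrow> openin (base M) U \<and> openin (Euclidean_space p) (\<phi> ` U) \<and>
        homeomorphic_map (subtopology (base M) U) (subtopology (Euclidean_space p) (\<phi> ` U)) \<phi>"
      if "z \<in> \<C>" for z
      using 1[of "fst z" "snd z"] that by (simp add: case_prod_unfold)
    show "case z of (U, \<phi>) \<Rightarrow> \<forall>(V, \<theta>)\<in>\<C>. \<forall>i<p. smooth_on p (\<phi> ` (U \<inter> V)) (\<lambda>x. \<theta> (inv_into U \<phi> x) i)"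
      if "z \<in> \<C>" for z
      using 3[of "fst z" "snd z"] that by (simp add: case_prod_unfold)
  qed
qed

sublocale smooth_mfd p "base M" \<C>
  by unfold_locales (rule smooth_manifold_base_atlas)

abbreviation "S \<equiv> smooth_function_sheaf n p (base M) \<C>"

lemma base_projection_smooth:
  assumes V: "opn V" and f: "f \<in> carrier (sect M V)"
  shows "\<epsilon> V f \<in> smooth_functions p \<C> V"
proof -
  have "smooth_on p (\<phi> ` (V \<inter> U)) (\<lambda>x. \<epsilon> V f (inv_into U \<phi> x))" if "(U, \<phi>) \<in> \<C>" for U \<phi>
    using that by (elim base_atlasE) (rule base_projection_coordinates[OF _ V f])
  then show ?thesis
    using base_projection_extensional by (auto simp: smooth_functions_def)
qed

lemma base_projection_algebra_hom:
  assumes V: "opn V"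
  shows "graded_algebra_hom n (sect M V) (sect S V) (\<epsilon> V)"
proof -
  interpret A: graded_comm_algebra n "sect M V" by (rule sect_algebra[OF V])
  have eqI: "\<epsilon> V f = (\<lambda>m\<in>V. h m)" if "\<And>m. m \<in> V \<Longrightarrow> \<epsilon> V f m = h m" for f h
    by (rule extensionalityI[OF base_projection_extensional restrict_extensional]) (simp add: that)
  have hom: "h ` homog (sect M V) i \<subseteq> homog (sect S V) i" if "h = \<epsilon> V" "i \<in> Z2n n" for h i
    using base_projection_homog[OF V that(2)] base_projection_smooth[OF V]
      A.submoduleE(1)[OF A.homog_submodule[OF that(2)]] that(1) by auto
  have one: "\<epsilon> V \<one>\<^bsub>sect M V\<^esub> = (\<lambda>m\<in>V. 1)"
    by (rule eqI) (rule base_projection_hom(4)[OF V _ A.one_closed A.one_closed])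
  show ?thesis
    unfolding graded_algebra_hom_def graded_linear_def smooth_function_sheaf_simps(2-7)
    using base_projection_smooth[OF V] base_projection_hom(1-3)[OF V] eqI hom one by (auto simp del: smooth_function_sheaf_simps)
qed

lemma base_projection_morphism: "algebra_sheaf_morphism n M S \<epsilon>"
  unfolding algebra_sheaf_morphism_def graded_sheaf_morphism_def
  using base_projection_algebra_hom graded_algebra_homD(1)[OF base_projection_algebra_hom] base_projection_restr
  by simp

text \<open>Inside one chart a smooth function is a body; the shrinking to
  \<open>V \<inter> U\<close> serves to get there.\<close>

lemma base_projection_surj:
  assumes V: "opn V" "m \<in> V" and h: "h \<in> smooth_functions p \<C> V"
  shows "\<exists>W g. opn W \<and> m \<in> W \<and> W \<subseteq> V \<and> g \<in> carrier (sect M W) \<and> \<epsilon> W g = restrict h W"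
proof -
  obtain U ds D \<phi> \<psi> \<phi>' \<psi>' where c: "superchart n M p U ds D \<phi> \<psi> \<phi>' \<psi>'" "m \<in> U"
    using superchart_in[OF V] .
  interpret superchart n M p U ds D \<phi> \<psi> \<phi>' \<psi>' by (rule c)
  have U: "(U, \<phi>) \<in> \<C>" using c superchart_base_atlas by blast
  have VU: "opn (V \<inter> U)" using V open_dom by blast
  obtain g where g: "g \<in> carrier (sect M (V \<inter> U))"
    "\<And>x. x \<in> V \<inter> U \<Longrightarrow> \<epsilon> (V \<inter> U) g x = h (inv_into U \<phi> (\<phi> x))"
    using base_projection_lift[OF c(1) VU _ smooth_functions_chart[OF h U]] by blast
  have "\<epsilon> (V \<inter> U) g = restrict h (V \<inter> U)"
    using g(2) superchart.chart_inj[OF c(1)]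
    by (intro extensionalityI[OF base_projection_extensional restrict_extensional]) simp
  then show ?thesis using g(1) VU V(2) c(2) by blast
qed

section \<open>The kernel of the base projection as a graded sheaf\<close>

lemma mem_base_kernel:
  "f \<in> base_kernel M V \<longleftrightarrow> f \<in> carrier (sect M V) \<and> (\<forall>m\<in>V. \<epsilon> V f m = 0)"
  using extensionalityI[OF base_projection_extensional restrict_extensional, of V f "\<lambda>_. 0"]
  unfolding base_kernel_def by auto

lemma restr_base_kernel:
  "opn V \<Longrightarrow> opn W \<Longrightarrow> W \<subseteq> V \<Longrightarrow> f \<in> base_kernel M V \<Longrightarrow> restr M V W f \<in> base_kernel M W"
  using base_projection_restr restr_closed unfolding mem_base_kernel by auto

lemma kernel_sheaf_simps [simp]:
  "base (kernel_sheaf M) = base M"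
  "restr (kernel_sheaf M) = restr M"
  "sect (kernel_sheaf M) V =
    (sect M V)\<lparr>carrier := base_kernel M V, homog := \<lambda>i. homog (sect M V) i \<inter> base_kernel M V\<rparr>"
  by (simp_all add: kernel_sheaf_def)

text \<open>What has to be shown is homogeneity. Components of nonzero degree are always in the
  kernel, which leaves a single component to be treated by subtraction.\<close>

lemma graded_space_base_kernel:
  assumes V: "opn V"
  shows "graded_space n (sect (kernel_sheaf M) V)"
proof -
  interpret A: graded_comm_algebra n "sect M V" by (rule sect_algebra[OF V])
  have ker: "f \<in> base_kernel M V" if "f \<in> homog (sect M V) i" "i \<in> Z2n n" "i \<noteq> deg_zero n" for f i
    using base_projection_homog[OF V that(2,3,1)] A.submoduleE(1)[OF A.homog_submodule[OF that(2)]] that(1)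
    unfolding base_kernel_def by blast
  have add: "a \<oplus>\<^bsub>sect M V\<^esub> b \<in> base_kernel M V" if "a \<in> base_kernel M V" "b \<in> base_kernel M V" for a b
    using that base_projection_hom(2)[OF V] unfolding mem_base_kernel by auto
  have zero: "\<zero>\<^bsub>sect M V\<^esub> \<in> base_kernel M V"
    using graded_linear_zero[OF A.graded_space_axioms _ graded_algebra_homD(1)[OF base_projection_algebra_hom[OF V]]]
      graded_comm_algebra.axioms(1)[OF graded_algebra_smooth_functions[OF V]]
    unfolding base_kernel_def by simp
  have sum: "(\<Oplus>\<^bsub>sect M V\<^esub>i\<in>I. c i) \<in> base_kernel M V"
    if "finite I" "\<And>i. i \<in> I \<Longrightarrow> c i \<in> base_kernel M V" for I and c :: "bool list \<Rightarrow> 'a"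
    using that
  proof (induction I rule: finite_induct)
    case (insert i I)
    then have "c \<in> I \<rightarrow> carrier (sect M V)" "c i \<in> carrier (sect M V)"
      unfolding mem_base_kernel by auto
    then show ?case using insert add by simp
  qed (simp add: zero)
  show ?thesis
    unfolding kernel_sheaf_simps
  proof (rule graded_subspace[OF A.graded_space_axioms _ zero add])
    show "base_kernel M V \<subseteq> carrier (sect M V)" by (auto simp: mem_base_kernel)
    show "r \<odot>\<^bsub>sect M V\<^esub> a \<in> base_kernel M V" if "a \<in> base_kernel M V" for r a
      using that base_projection_hom(3)[OF V] unfolding mem_base_kernel by auto
    fix c i assume c: "c \<in> (\<Pi>\<^sub>E i\<in>Z2n n. homog (sect M V) i)"
      and s: "(\<Oplus>\<^bsub>sect M V\<^esub>i\<in>Z2n n. c i) \<in> base_kernel M V" and i: "i \<in> Z2n n"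
    have cc: "c i \<in> carrier (sect M V)" if "i \<in> Z2n n" for i
      using c A.submoduleE(1)[OF A.homog_submodule[OF that]] that by blast
    show "c i \<in> base_kernel M V"
    proof (cases "i = deg_zero n")
      case True
      \<comment> \<open>The degree-zero component is the whole sum minus this remainder, and
        \<epsilon> vanishes on both.\<close>
      let ?r = "\<Oplus>\<^bsub>sect M V\<^esub>j\<in>Z2n n - {i}. c j"
      have r: "?r \<in> base_kernel M V"
        using ker c True by (intro sum) (auto simp: finite_Z2n)
      have "Z2n n = insert i (Z2n n - {i})" using i by blast
      then have "(\<Oplus>\<^bsub>sect M V\<^esub>j\<in>Z2n n. c j) = c i \<oplus>\<^bsub>sect M V\<^esub> ?r"
        using A.finsum_insert[of "Z2n n - {i}" i c] finite_Z2n[of n] cc i by auto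
      then have "\<epsilon> V (c i) m = 0" if "m \<in> V" for m
        using s r base_projection_hom(2)[OF V that cc[OF i], of ?r] that unfolding mem_base_kernel by simp
      then show ?thesis using cc[OF i] unfolding mem_base_kernel by blast
    next
      case False
      then show ?thesis using ker c i by blast
    qed
  qed auto
qed

lemma kernel_sheaf: "graded_sheaf n (kernel_sheaf M)"
  unfolding graded_sheaf_def
proof (intro conjI allI impI)
  show "graded_space n (sect (kernel_sheaf M) U)" if "openin (base (kernel_sheaf M)) U" for U
    using that graded_space_base_kernel by simp
  show "graded_linear n (sect (kernel_sheaf M) U) (sect (kernel_sheaf M) V) (restr (kernel_sheaf M) U V)"
    if "openin (base (kernel_sheaf M)) U \<and> openin (base (kernel_sheaf M)) V \<and> V \<subseteq> U" for U V
    using that restr_linear[of U V] restr_base_kernel[of U V]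
    by (auto simp: graded_linear_def mem_base_kernel subset_iff)
  show "\<forall>f\<in>carrier (sect (kernel_sheaf M) U). restr (kernel_sheaf M) U U f = f"
    if "openin (base (kernel_sheaf M)) U" for U
    using that restr_self by (simp add: mem_base_kernel)
  show "\<forall>f\<in>carrier (sect (kernel_sheaf M) U).
      restr (kernel_sheaf M) V W (restr (kernel_sheaf M) U V f) = restr (kernel_sheaf M) U W f"
    if "openin (base (kernel_sheaf M)) U \<and> openin (base (kernel_sheaf M)) V \<and>
      openin (base (kernel_sheaf M)) W \<and> V \<subseteq> U \<and> W \<subseteq> V" for U V W
    using that restr_restr by (simp add: mem_base_kernel)
next
  fix \<U> s
  assume a: "(\<forall>U\<in>\<U>. openin (base (kernel_sheaf M)) U \<and> s U \<in> carrier (sect (kernel_sheaf M) U)) \<and>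
    (\<forall>U\<in>\<U>. \<forall>V\<in>\<U>. restr (kernel_sheaf M) U (U \<inter> V) (s U) = restr (kernel_sheaf M) V (U \<inter> V) (s V))"
  then have \<U>: "\<And>U. U \<in> \<U> \<Longrightarrow> opn U" "\<And>U. U \<in> \<U> \<Longrightarrow> s U \<in> base_kernel M U"
    by simp_all
  have compat: "restr M U (U \<inter> V) (s U) = restr M V (U \<inter> V) (s V)" if "U \<in> \<U>" "V \<in> \<U>" for U V
    using bspec[OF bspec[OF conjunct2[OF a] that(1)] that(2)] by simp
  have sc: "\<And>U. U \<in> \<U> \<Longrightarrow> s U \<in> carrier (sect M U)"
    using \<U>(2) mem_base_kernel by blast
  have ex1: "\<exists>!f. f \<in> carrier (sect M (\<Union>\<U>)) \<and> (\<forall>U\<in>\<U>. restr M (\<Union>\<U>) U f = s U)"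
    by (rule glue[OF \<U>(1) sc compat])
  \<comment> \<open>Gluing happens in \<open>M\<close>. Vanishing of \<epsilon> can be tested on
    each member of the cover, so the glued section returns to the kernel, and uniqueness is that of
    \<open>M\<close>.\<close>
  have "f \<in> base_kernel M (\<Union>\<U>)"
    if f: "f \<in> carrier (sect M (\<Union>\<U>))" "\<forall>U\<in>\<U>. restr M (\<Union>\<U>) U f = s U" for f
    unfolding mem_base_kernel
  proof (intro conjI ballI f(1))
    fix m assume "m \<in> \<Union>\<U>"
    then obtain U where U: "U \<in> \<U>" "m \<in> U" by blast
    have "\<epsilon> U (s U) = restrict (\<epsilon> (\<Union>\<U>) f) U"
      using base_projection_restr[of "\<Union>\<U>" U f] f U(1) \<U>(1) by auto
    then show "\<epsilon> (\<Union>\<U>) f m = 0"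
      using \<U>(2)[OF U(1)] U(2) unfolding mem_base_kernel by simp
  qed
  then have "f \<in> base_kernel M (\<Union>\<U>) \<and> (\<forall>U\<in>\<U>. restr M (\<Union>\<U>) U f = s U) \<longleftrightarrow>
      f \<in> carrier (sect M (\<Union>\<U>)) \<and> (\<forall>U\<in>\<U>. restr M (\<Union>\<U>) U f = s U)" for f
    unfolding mem_base_kernel by blast
  with ex1 show "\<exists>!f. f \<in> carrier (sect (kernel_sheaf M) (\<Union>\<U>)) \<and>
      (\<forall>U\<in>\<U>. restr (kernel_sheaf M) (\<Union>\<U>) U f = s U)"
    by simp
qed

lemma kernel_sheaf_inclusion: "graded_sheaf_morphism n (kernel_sheaf M) M (\<lambda>U f. f)"
  unfolding graded_sheaf_morphism_def graded_linear_def by (auto simp: mem_base_kernel)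

text \<open>Injectivity and exactness in the middle hold by the definition of
  \<open>base_kernel\<close>; the content is in surjectivity after shrinking.\<close>

lemma base_projection_exact: "short_exact_sequence n (kernel_sheaf M) M S (\<lambda>U f. f) \<epsilon>"
proof (rule short_exact_sequenceI[OF kernel_sheaf graded_sheaf _ kernel_sheaf_inclusion])
  show "graded_sheaf n S"
    using smooth_function_sheaf[of n] by (simp add: graded_comm_algebra_sheaf_def)
  show "graded_sheaf_morphism n M S \<epsilon>"
    using base_projection_morphism by (simp add: algebra_sheaf_morphism_def)
  show "\<exists>W g. opn W \<and> m \<in> W \<and> W \<subseteq> U \<and> g \<in> carrier (sect M W) \<and> \<epsilon> W g = restr S U W h"
    if "opn U" "m \<in> U" "h \<in> carrier (sect S U)" for U m h
    using base_projection_surj[OF that(1,2), of h] that(3) by simp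
qed (auto simp: base_kernel_def)

end

theorem proposition6p1:
  fixes n p :: nat and qs :: "nat list" and M :: "('m, 'a) ringed_space"
  assumes "length qs = 2 ^ n - 1"
    and "supermanifold n p qs M"
  shows "\<exists>\<C>. smooth_manifold p (base M) \<C> \<and>
    graded_comm_algebra_sheaf n (smooth_function_sheaf n p (base M) \<C>) \<and>
    algebra_sheaf_morphism n M (smooth_function_sheaf n p (base M) \<C>) (base_projection M) \<and>
    short_exact_sequence n (kernel_sheaf M) M (smooth_function_sheaf n p (base M) \<C>)
      (\<lambda>U f. f) (base_projection M)"
proof -
  have lrs: "locally_ringed_space n M"
    using assms(2) by (simp add: supermanifold_def)
  interpret sheaf_of_graded_algebras n M
    using lrs by (intro sheaf_of_graded_algebrasI) (simp add: locally_ringed_space_def)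
  interpret base_supermanifold n M p
    by unfold_locales (use lrs supermanifold_superchart[OF assms(2)] in \<open>simp_all add: locally_ringed_space_def\<close>)
  show ?thesis
    using smooth_manifold_base_atlas smooth_function_sheaf[of n] base_projection_morphism base_projection_exact
    by blast
qed

end
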